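(* Let $\nu\ge 3$. Then there exist a constant $C=C(\nu)>0$ and an exponent $\alpha\ge\frac{1}{1+\nu}$ such that for every $N\in\mathbb N$ and all permutations $P,Q\in\mathcal D_N$ of the tiling $\mathcal R_N$ of $[0,1]^\nu$, $$\mathrm{dist}_{\mathcal D_N}(P,Q)\le C\,\|P-Q\|_{2}^{\alpha}.$$ Moreover, if $\nu=2$, the same statement holds with some $\alpha\ge\frac27$.
   Context: $\mathcal R_N$ is the tiling of $[0,1]^\nu$ by $N^\nu$ closed axis-parallel cubes of side $N^{-1}$; $c(\kappa)$ is the center of a cube $\kappa\in\mathcal R_N$. $\mathcal D_N$ is the group of permutations of $\mathcal R_N$: measure-preserving maps $P:[0,1]^\nu\to[0,1]^\nu$ (up to null sets) which send each cube of $\mathcal R_N$ onto a cube of $\mathcal R_N$ bijectively, by translation: $P(x)=x+c(P(\kappa))-c(\kappa)$ for $x\in\mathrm{int}(\kappa)$. $\|P-Q\|_2$ is the norm of $P-Q$ in $L^2([0,1]^\nu;\mathbb R^\nu)$. A rectangle is a set $\prod_{i=1}^\nu[h_i/N,\tilde h_i/N]$ with integers $0\le h_i<\tilde h_i\le N$; an array $A$ is a rectangle which has side $1/N$ in all coordinate directions but one; its length $\ell(A)$ is the number of cubes of $\mathcal R_N$ it contains, and we write $A=[\kappa_1,\dots,\kappa_{\ell(A)}]$ for its consecutive cubes. Sets are called disjoint if their interiors are disjoint. A sequence of $h$ swapping couples in an array $A=[\kappa_1,\dots,\kappa_{\ell(A)}]$ is given by indices $p_1<p_2<\dots<p_{2h}$,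 $2h\le\ell(A)$; its couples are $(\kappa_{p_j},\kappa_{p_{2h-j+1}})$, $j=1,\dots,h$ (nested couples). An elementary movement $Z:[0,1]^\nu\to[0,1]^\nu$ is given by pairwise disjoint arrays $A_1,\dots,A_m$ and, for each $i$, a sequence of $h(i)$ swapping couples in $A_i$: $Z$ exchanges by translation the two cubes of each couple, and is the identity elsewhere. Its cost is $L(Z)=\max_i\ell(A_i)\,N^{-1-\frac\nu2}\sqrt{\sum_{i=1}^m h(i)}$ (computed from the given arrays and couples). A discrete flow is a finite sequence $\{Z_k\}_{k=1}^T$ of elementary movements; its length is $L\{Z_k\}_{k=1}^T=\sum_{k=1}^T L(Z_k)$; it connects $P$ to $Q$ if $Z_T\circ\cdots\circ Z_1\circ P=Q$. Finally $\mathrm{dist}_{\mathcal D_N}(P,Q)$ is the minimum of $L\{Z_k\}$ over all discrete flows connecting $P$ to $Q$ (it is $0$ if $P=Q$). *)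

theory Defs
  imports "HOL-Analysis.Analysis"
begin

abbreviation unit_cube :: "(real^'n::finite) set" where
  "unit_cube \<equiv> cbox 0 1"

definition rectangle :: "nat \<Rightarrow> nat^'n \<Rightarrow> nat^'n \<Rightarrow> (real^'n::finite) set" where
  "rectangle N h h' = cbox (\<chi> i. real (h $ i) / real N) (\<chi> i. real (h' $ i) / real N)"

definition is_rectangle :: "nat \<Rightarrow> nat^'n \<Rightarrow> nat^'n::finite \<Rightarrow> bool" where
  "is_rectangle N h h' \<longleftrightarrow> (\<forall>i. h $ i < h' $ i \<and> h' $ i \<le> N)"

definition tiling :: "nat \<Rightarrow> (real^'n::finite) set set" where
  "tiling N = {rectangle N h (h + 1) |h. is_rectangle N h (h + 1)}"

definition center :: "(real^'n::finite) set \<Rightarrow> real^'n" where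
  "center \<kappa> = midpoint (interval_lowerbound \<kappa>) (interval_upperbound \<kappa>)"

definition measure_preserving :: "'a measure \<Rightarrow> ('a \<Rightarrow> 'a) \<Rightarrow> bool" where
  "measure_preserving M P \<longleftrightarrow> P \<in> M \<rightarrow>\<^sub>M M \<and> distr M M P = M"

text \<open>Members of the set below are representatives of almost-everywhere classes; their values on
  the faces of the cubes, a null set, are arbitrary points of the unit cube.  That distinct cubes
  go to distinct cubes follows from measure preservation.\<close>

definition cube_perms :: "nat \<Rightarrow> (real^'n::finite \<Rightarrow> real^'n) set" where
  "cube_perms N = {P. measure_preserving (lebesgue_on unit_cube) P \<and>
     (\<forall>\<kappa>\<in>tiling N. \<exists>\<kappa>'\<in>tiling N. \<forall>x\<in>interior \<kappa>. P x = x + center \<kappa>' - center \<kappa>)}"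

definition L2_dist :: "(real^'n::finite \<Rightarrow> real^'n) \<Rightarrow> (real^'n \<Rightarrow> real^'n) \<Rightarrow> real" where
  "L2_dist P Q = sqrt (LINT x|lebesgue_on unit_cube. (norm (P x - Q x))\<^sup>2)"

text \<open>An array is stored as a coordinate direction together with the integer corners of its
  rectangle.  An array consisting of a single cube is allowed; it cannot carry a couple.\<close>

datatype 'n array = Array (direction: "'n::finite") (lower: "nat^'n") (upper: "nat^'n")

definition array_set :: "nat \<Rightarrow> 'n array \<Rightarrow> (real^'n::finite) set" where
  "array_set N A = rectangle N (lower A) (upper A)"

definition is_array :: "nat \<Rightarrow> 'n::finite array \<Rightarrow> bool" where
  "is_array N A \<longleftrightarrow> is_rectangle N (lower A) (upper A) \<and>
     (\<forall>i. i \<noteq> direction A \<longrightarrow> upper A $ i = lower A $ i + 1)"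

definition array_length :: "nat \<Rightarrow> 'n::finite array \<Rightarrow> nat" where
  "array_length N A = card {\<kappa> \<in> tiling N. \<kappa> \<subseteq> array_set N A}"

text \<open>The cubes of an array are numbered from 1, by increasing coordinate in its direction.  Couples
  are nested and unordered, so the opposite numbering would give the same couples.\<close>

definition array_cube :: "nat \<Rightarrow> 'n array \<Rightarrow> nat \<Rightarrow> (real^'n::finite) set" where
  "array_cube N A k =
     (let h = lower A + axis (direction A) (k - 1) in rectangle N h (h + 1))"

definition is_swap_seq :: "nat \<Rightarrow> 'n::finite array \<Rightarrow> nat list \<Rightarrow> bool" where
  "is_swap_seq N A p \<longleftrightarrow>
     even (length p) \<and> sorted_wrt (<) p \<and> set p \<subseteq> {1..array_length N A}"

definition num_couples :: "nat list \<Rightarrow> nat" where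
  "num_couples p = length p div 2"

text \<open>List positions start at 0, so the index \<open>p\<^sub>j\<close> is \<open>p ! (j - 1)\<close> and
  \<open>p\<^sub>2\<^sub>h\<^sub>-\<^sub>j\<^sub>+\<^sub>1\<close> is \<open>p ! (2 * h - j)\<close>.\<close>

definition couples ::
  "nat \<Rightarrow> 'n array \<times> nat list \<Rightarrow> ((real^'n::finite) set \<times> (real^'n) set) list" where
  "couples N = (\<lambda>(A, p). map (\<lambda>j. (array_cube N A (p ! (j - 1)),
     array_cube N A (p ! (2 * num_couples p - j)))) [1..<num_couples p + 1])"

type_synonym 'n movement = "('n array \<times> nat list) list"

definition elementary_movement :: "nat \<Rightarrow> 'n::finite movement \<Rightarrow> bool" where
  "elementary_movement N Z \<longleftrightarrow> Z \<noteq> [] \<and>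
     (\<forall>(A, p)\<in>set Z. is_array N A \<and> is_swap_seq N A p) \<and>
     sorted_wrt (\<lambda>(A, p) (B, q).
       interior (array_set N A) \<inter> interior (array_set N B) = {}) Z"

definition swap_cubes ::
  "(real^'n::finite) set \<times> (real^'n) set \<Rightarrow> real^'n \<Rightarrow> real^'n" where
  "swap_cubes = (\<lambda>(\<kappa>, \<kappa>') x.
     if x \<in> interior \<kappa> then x + center \<kappa>' - center \<kappa>
     else if x \<in> interior \<kappa>' then x + center \<kappa> - center \<kappa>'
     else x)"

text \<open>The cubes of all couples of a movement are distinct, so the swaps act on disjoint sets and
  the order in which they are composed is irrelevant.\<close>

definition movement_map :: "nat \<Rightarrow> 'n movement \<Rightarrow> real^'n::finite \<Rightarrow> real^'n" where
  "movement_map N Z = fold swap_cubes (concat (map (couples N) Z))"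

definition movement_cost :: "nat \<Rightarrow> 'n::finite movement \<Rightarrow> real" where
  "movement_cost N Z =
     real (Max ((\<lambda>(A, p). array_length N A) ` set Z)) *
     real N powr (- 1 - real CARD('n) / 2) *
     sqrt (real (\<Sum>(A, p)\<leftarrow>Z. num_couples p))"

definition discrete_flow :: "nat \<Rightarrow> 'n::finite movement list \<Rightarrow> bool" where
  "discrete_flow N Zs \<longleftrightarrow> (\<forall>Z\<in>set Zs. elementary_movement N Z)"

definition flow_length :: "nat \<Rightarrow> 'n::finite movement list \<Rightarrow> real" where
  "flow_length N Zs = (\<Sum>Z\<leftarrow>Zs. movement_cost N Z)"

definition connects ::
  "nat \<Rightarrow> 'n movement list \<Rightarrow> (real^'n::finite \<Rightarrow> real^'n) \<Rightarrow> (real^'n \<Rightarrow> real^'n) \<Rightarrow> bool" where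
  "connects N Zs P Q \<longleftrightarrow>
     (AE x in lebesgue_on unit_cube. fold (movement_map N) Zs (P x) = Q x)"

definition flow_dist ::
  "nat \<Rightarrow> (real^'n::finite \<Rightarrow> real^'n) \<Rightarrow> (real^'n \<Rightarrow> real^'n) \<Rightarrow> real" where
  "flow_dist N P Q = (LEAST l. \<exists>Zs :: 'n movement list.
     discrete_flow N Zs \<and> connects N Zs P Q \<and> l = flow_length N Zs)"

end

theory Submission
  imports Defs
begin

text \<open>
The exponent \<open>\<alpha> = 1/3\<close> works in every dimension \<open>\<nu>\<close>.  Let \<open>\<epsilon> = \<parallel>P - Q\<parallel>\<close>, and let \<open>\<sigma> = Q \<circ> P\<^sup>-\<^sup>1\<close> act on the cubes.
A permutation along lines is sorted by quicksort: at each level one movement with nested couples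
suffices, and the array lengths decrease geometrically.  An arbitrary permutation is a product of
\<open>O(\<nu>)\<close> permutations along lines, obtained from edge colourings of regular bipartite multigraphs; they
can be chosen to move only \<open>O(m)\<close> cubes if the given permutation moves \<open>m\<close> cubes.  Hence a permutation
that moves a fraction \<open>\<mu>\<close> of the cubes, each within its block of width \<open>b\<close>, costs \<open>O(b \<surd>\<mu>)\<close>.
Cut the unit cube into blocks of width \<open>b \<approx> \<epsilon>\<^sup>1\<^sup>/\<^sup>3\<close>, suitably shifted.  By averaging over the shifts, \<open>\<sigma>\<close> moves
only a fraction \<open>O(\<epsilon>/b)\<close> of the cubes to other blocks.  Bring these to the right blocks at cost
\<open>O(\<surd>(\<epsilon>/b))\<close>, and then permute inside the blocks at cost \<open>O(b)\<close>.
\<close>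

section \<open>Edge colourings of regular multigraphs\<close>

text \<open>The width \<open>b\<close> balances the costs of the two stages:
  \<open>sqrt (\<epsilon> / b) = b\<close> gives \<open>b = \<epsilon>^(1/3)\<close>, and 1/3 is at
  least \<open>1 / (1 + \<nu>)\<close> for \<open>\<nu> \<ge> 3\<close> and exceeds 2/7. The
  obstacle is the first stage. Few cubes travel there over distances up to 1, and this is cheap only
  because the number of couples stands under a square root. Routing must therefore not disturb many
  further cubes, while an arbitrary edge colouring may give nearly every cube a foreign intermediate
  coordinate. This is why the colouring is made to prefer the coordinate that a cube already has.
  Nested couples suffice for quicksort because one level only has to put each cube into the correct
  half: any pairing of the misplaced cubes on the left with the equally many misplaced ones on the
  right will do, in particular the nested one. The fraction \<open>\<epsilon> / b\<close> arises
  since a displacement by \<open>d\<close> along an axis crosses a block boundary for at most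
  \<open>d\<close> of the \<open>w\<close> shifts, and Cauchy-Schwarz bounds the total displacement
  by the quadratic one.\<close>

lemma hall_marriage:
  assumes "finite I" "\<And>i. i \<in> I \<Longrightarrow> finite (A i)"
    and "\<And>J. J \<subseteq> I \<Longrightarrow> card J \<le> card (\<Union>(A ` J))"
  shows "\<exists>R. inj_on R I \<and> (\<forall>i\<in>I. R i \<in> A i)"
  using assms
proof (induction I arbitrary: A rule: finite_psubset_induct)
  case (psubset I)
  show ?case
  \<comment> \<open>The Halmos-Vaughan split. A tight proper subfamily is matched first and its
    values are withdrawn from the others. If there is none, every nonempty proper subfamily has a
    surplus, which survives the withdrawal of one value.\<close>
  proof (cases "\<exists>J. J \<noteq> {} \<and> J \<subset> I \<and> card (\<Union>(A ` J)) \<le> card J")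
    case True
    then obtain J where J: "J \<noteq> {}" "J \<subset> I" "card (\<Union>(A ` J)) \<le> card J" by blast
    have finJ: "finite J" using J psubset.hyps finite_subset by blast
    define U where "U = \<Union>(A ` J)"
    have finU: "finite U" unfolding U_def using finJ psubset.prems(1) J by blast
    have "\<exists>R. inj_on R J \<and> (\<forall>i\<in>J. R i \<in> A i)"
      by (rule psubset.IH[OF J(2)]) (use psubset.prems J(2) in auto)
    then obtain R1 where R1: "inj_on R1 J" "\<forall>i\<in>J. R1 i \<in> A i" by blast
    have sub: "I - J \<subset> I" using J by blast
    have hall: "card K \<le> card (\<Union>((\<lambda>i. A i - U) ` K))" if K: "K \<subseteq> I - J" for K
    proof -
      have finK: "finite K" using K psubset.hyps finite_subset by blast
      have fin2: "finite (\<Union>((\<lambda>i. A i - U) ` K))" using finK K psubset.prems(1) by blast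
      have "card K + card J = card (K \<union> J)"
        using finK finJ K by (subst card_Un_disjoint) auto
      also have "\<dots> \<le> card (\<Union>(A ` (K \<union> J)))"
        using psubset.prems(2) K J by (metis Diff_subset le_sup_iff psubset_imp_subset subset_trans)
      also have "\<Union>(A ` (K \<union> J)) = (\<Union>((\<lambda>i. A i - U) ` K)) \<union> U" by (auto simp: U_def)
      also have "card \<dots> \<le> card (\<Union>((\<lambda>i. A i - U) ` K)) + card U" by (rule card_Un_le)
      finally show ?thesis using J(3) by (simp add: U_def)
    qed
    have "\<exists>R. inj_on R (I - J) \<and> (\<forall>i\<in>I - J. R i \<in> A i - U)"
      by (rule psubset.IH[OF sub]) (use psubset.prems(1) hall in auto)
    then obtain R2 where R2: "inj_on R2 (I - J)" "\<forall>i\<in>I - J. R2 i \<in> A i - U" by blast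
    define R where "R i = (if i \<in> J then R1 i else R2 i)" for i
    have "R i = R j \<Longrightarrow> i = j" if "i \<in> I" "j \<in> I" for i j
    proof -
      have *: "R k \<in> U \<longleftrightarrow> k \<in> J" if "k \<in> I" for k
        using that R1(2) R2(2) by (auto simp: R_def U_def)
      show "R i = R j \<Longrightarrow> i = j"
        using *[OF that(1)] *[OF that(2)] that R1(1) R2(1)
        by (cases "i \<in> J"; cases "j \<in> J") (auto simp: R_def dest: inj_onD)
    qed
    then have "inj_on R I" by (auto intro: inj_onI)
    moreover have "\<forall>i\<in>I. R i \<in> A i" using R1(2) R2(2) by (auto simp: R_def)
    ultimately show ?thesis by blast
  next
    case False
    show ?thesis
    proof (cases "I = {}")
      case True then show ?thesis by simp
    next
      case nonempty: False
      then obtain i where i: "i \<in> I" by blast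
      have "card {i} \<le> card (\<Union>(A ` {i}))" using psubset.prems(2)[of "{i}"] i by blast
      then have "A i \<noteq> {}" by auto
      then obtain x where x: "x \<in> A i" by blast
      have sub: "I - {i} \<subset> I" using i by blast
      have hall: "card K \<le> card (\<Union>((\<lambda>j. A j - {x}) ` K))" if K: "K \<subseteq> I - {i}" for K
      proof (cases "K = {}")
        case True then show ?thesis by simp
      next
        case False
        then have lt: "card K < card (\<Union>(A ` K))"
          using \<open>\<not> (\<exists>J. J \<noteq> {} \<and> J \<subset> I \<and> card (\<Union>(A ` J)) \<le> card J)\<close> K sub
          by (meson leI subset_psubset_trans)
        have "\<Union>((\<lambda>j. A j - {x}) ` K) = \<Union>(A ` K) - {x}" by blast
        then have "card (\<Union>((\<lambda>j. A j - {x}) ` K)) \<ge> card (\<Union>(A ` K)) - 1"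
          by (simp add: card_Diff_singleton_if)
        then show ?thesis using lt by linarith
      qed
      have "\<exists>R. inj_on R (I - {i}) \<and> (\<forall>j\<in>I - {i}. R j \<in> A j - {x})"
        by (rule psubset.IH[OF sub]) (use psubset.prems(1) hall in auto)
      then obtain R where R: "inj_on R (I - {i})" "\<forall>j\<in>I - {i}. R j \<in> A j - {x}" by blast
      have "inj_on (R(i := x)) I" using R by (auto simp: inj_on_def)
      moreover have "\<forall>j\<in>I. (R(i := x)) j \<in> A j" using R x by auto
      ultimately show ?thesis by blast
    qed
  qed
qed

lemma card_fibres:
  assumes "finite X" "finite V" "f ` X \<subseteq> V"
  shows "card X = (\<Sum>v\<in>V. card {x \<in> X. f x = v})"
proof -
  have "card X = card (\<Union>v\<in>V. {x \<in> X. f x = v})"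
    by (rule arg_cong[where f = card]) (use assms(3) in auto)
  also have "\<dots> = (\<Sum>v\<in>V. card {x \<in> X. f x = v})"
    by (rule card_UN_disjoint) (use assms in auto)
  finally show ?thesis .
qed

text \<open>Hall's condition by double counting: the \<open>d * card S\<close> edges that start in
  \<open>S\<close> all end in the neighbourhood \<open>T\<close>, where only
  \<open>d * card T\<close> edges end. The result is a set of edges rather than a map of vertices,
  so that it can be removed from a multigraph with parallel edges.\<close>

lemma regular_perfect_matching:
  assumes "finite X" "finite V" "d > 0"
    and aV: "a ` X \<subseteq> V" and bV: "b ` X \<subseteq> V"
    and a: "\<And>v. v \<in> V \<Longrightarrow> card {x \<in> X. a x = v} = d"
    and b: "\<And>v. v \<in> V \<Longrightarrow> card {x \<in> X. b x = v} = d"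
  shows "\<exists>M\<subseteq>X. bij_betw a M V \<and> bij_betw b M V"
proof -
  define A where "A v = b ` {x \<in> X. a x = v}" for v
  have hall: "card S \<le> card (\<Union>(A ` S))" if S: "S \<subseteq> V" for S
  proof -
    have finS: "finite S" using S assms finite_subset by blast
    define T where "T = \<Union>(A ` S)"
    have TV: "T \<subseteq> V" unfolding T_def A_def using bV by blast
    have finT: "finite T" using TV assms finite_subset by blast
    have "d * card S = (\<Sum>v\<in>S. card {x \<in> X. a x = v})"
      using S a by (simp add: subset_iff)
    also have "\<dots> = (\<Sum>v\<in>S. card {x \<in> {x\<in>X. a x \<in> S}. a x = v})"
      by (rule sum.cong) (auto intro!: arg_cong[where f = card])
    also have "\<dots> = card {x \<in> X. a x \<in> S}"
      by (rule card_fibres[symmetric]) (use assms finS in auto)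
    also have "\<dots> \<le> card {x \<in> X. b x \<in> T}"
      by (rule card_mono) (use assms in \<open>auto simp: T_def A_def\<close>)
    also have "\<dots> = (\<Sum>v\<in>T. card {x \<in> {x\<in>X. b x \<in> T}. b x = v})"
      by (rule card_fibres) (use assms finT in auto)
    also have "\<dots> = (\<Sum>v\<in>T. card {x \<in> X. b x = v})"
      by (rule sum.cong) (auto intro!: arg_cong[where f = card])
    also have "\<dots> = d * card T"
      using TV b by (simp add: subset_iff)
    finally show ?thesis using \<open>d > 0\<close> by (simp add: T_def)
  qed
  have "\<exists>R. inj_on R V \<and> (\<forall>v\<in>V. R v \<in> A v)"
    by (rule hall_marriage) (use assms(1,2) hall in \<open>auto simp: A_def\<close>)
  then obtain R where R: "inj_on R V" "\<forall>v\<in>V. R v \<in> A v" by blast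
  then have "\<forall>v\<in>V. \<exists>x. x \<in> X \<and> a x = v \<and> b x = R v" by (force simp: A_def)
  then obtain e where e: "\<And>v. v \<in> V \<Longrightarrow> e v \<in> X \<and> a (e v) = v \<and> b (e v) = R v" by metis
  have RV: "R ` V \<subseteq> V" using e bV by (metis image_subset_iff)
  have [simp]: "R ` V = V" using R(1) RV \<open>finite V\<close> by (simp add: endo_inj_surj)
  then have "bij_betw a (e ` V) V" "bij_betw b (e ` V) V"
    by (auto simp: bij_betw_def inj_on_def e image_image dest: inj_onD[OF R(1)])
  then show ?thesis using e by blast
qed

text \<open>Koenig's edge colouring: \<open>a x\<close> and \<open>b x\<close> are the two ends of the edge \<open>x\<close>.\<close>

lemma regular_edge_coloring:
  assumes "finite I" "finite X" "finite V"
    and "a ` X \<subseteq> V" "b ` X \<subseteq> V"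
    and "\<And>v. v \<in> V \<Longrightarrow> card {x \<in> X. a x = v} = card I"
    and "\<And>v. v \<in> V \<Longrightarrow> card {x \<in> X. b x = v} = card I"
  shows "\<exists>\<gamma>. \<gamma> ` X \<subseteq> I \<and> inj_on (\<lambda>x. (a x, \<gamma> x)) X \<and> inj_on (\<lambda>x. (b x, \<gamma> x)) X"
  using assms
proof (induction I arbitrary: X rule: finite_induct)
  case empty
  have "card X = (\<Sum>v\<in>V. card {x \<in> X. a x = v})"
    by (rule card_fibres) (use empty.prems in auto)
  also have "\<dots> = 0" using empty.prems by simp
  finally have "X = {}" using empty.prems by simp
  then show ?case by simp
next
  case (insert i I)
  \<comment> \<open>The matching receives the new colour \<open>i\<close>; what remains is regular
    of degree one less.\<close>
  obtain M where M: "M \<subseteq> X" "bij_betw a M V" "bij_betw b M V"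
    using regular_perfect_matching[of X V "card (insert i I)" a b] insert.prems insert.hyps(1)
    by (auto simp: card_gt_0_iff)
  have fibre: "card {x \<in> X - M. f x = v} = card I"
    if f: "bij_betw f M V" and c: "card {x \<in> X. f x = v} = card (insert i I)" and v: "v \<in> V" for f v
  proof -
    obtain y where y: "y \<in> M" "f y = v" using f v by (auto simp: bij_betw_def)
    have "{x \<in> X - M. f x = v} = {x \<in> X. f x = v} - {y}"
      using y f by (auto simp: bij_betw_def inj_on_def)
    then show ?thesis using c y M(1) insert.hyps by (auto simp: card_Diff_singleton)
  qed
  have "\<exists>\<gamma>. \<gamma> ` (X - M) \<subseteq> I \<and> inj_on (\<lambda>x. (a x, \<gamma> x)) (X - M) \<and> inj_on (\<lambda>x. (b x, \<gamma> x)) (X - M)"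
    by (rule insert.IH) (use insert.prems M fibre in auto)
  then obtain \<gamma> where \<gamma>: "\<gamma> ` (X - M) \<subseteq> I" "inj_on (\<lambda>x. (a x, \<gamma> x)) (X - M)"
    "inj_on (\<lambda>x. (b x, \<gamma> x)) (X - M)" by blast
  define \<gamma>' where "\<gamma>' x = (if x \<in> M then i else \<gamma> x)" for x
  have *: "inj_on (\<lambda>x. (f x, \<gamma>' x)) X"
    if f: "bij_betw f M V" and in1: "inj_on (\<lambda>x. (f x, \<gamma> x)) (X - M)" for f
  proof (rule inj_onI, clarsimp)
    fix x y assume xy: "x \<in> X" "y \<in> X" "f x = f y" "\<gamma>' x = \<gamma>' y"
    have "\<gamma>' z = i \<longleftrightarrow> z \<in> M" if "z \<in> X" for z
      using \<gamma>(1) that insert.hyps(2) by (auto simp: \<gamma>'_def)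
    then have "x \<in> M \<longleftrightarrow> y \<in> M" using xy by metis
    then show "x = y" using xy f in1 by (cases "x \<in> M") (auto simp: \<gamma>'_def bij_betw_def inj_on_def)
  qed
  have "\<gamma>' ` X \<subseteq> insert i I" using \<gamma>(1) by (auto simp: \<gamma>'_def)
  then show ?case using *[OF M(2) \<gamma>(2)] *[OF M(3) \<gamma>(3)] by blast
qed

text \<open>The colours of two parallel edges may be exchanged, so in a colouring with the largest number of
  loops of preferred colour, a loop of another colour sees its preferred colour on a non-loop.\<close>

lemma edge_coloring_preferred:
  assumes "finite X"
    and pref: "inj_on (\<lambda>x. (a x, p x)) X"
    and \<gamma>0: "inj_on (\<lambda>x. (a x, \<gamma>0 x)) X" "inj_on (\<lambda>x. (b x, \<gamma>0 x)) X"
    and img: "(\<lambda>x. (a x, \<gamma>0 x)) ` X = (\<lambda>x. (a x, p x)) ` X"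
  shows "\<exists>\<gamma>. inj_on (\<lambda>x. (a x, \<gamma> x)) X \<and> inj_on (\<lambda>x. (b x, \<gamma> x)) X \<and>
    (\<lambda>x. (a x, \<gamma> x)) ` X = (\<lambda>x. (a x, p x)) ` X \<and>
    card {x \<in> X. \<gamma> x \<noteq> p x} \<le> 2 * card {x \<in> X. a x \<noteq> b x}"
proof -
  define good where "good \<gamma> \<longleftrightarrow> inj_on (\<lambda>x. (a x, \<gamma> x)) X \<and> inj_on (\<lambda>x. (b x, \<gamma> x)) X \<and>
    (\<lambda>x. (a x, \<gamma> x)) ` X = (\<lambda>x. (a x, p x)) ` X" for \<gamma>
  define bad where "bad \<gamma> = {x \<in> X. a x = b x \<and> \<gamma> x \<noteq> p x}" for \<gamma>
  have "good \<gamma>0" using \<gamma>0 img by (simp add: good_def)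
  then obtain \<gamma> where good: "good \<gamma>" and min: "\<And>\<gamma>'. good \<gamma>' \<Longrightarrow> card (bad \<gamma>) \<le> card (bad \<gamma>')"
    using arg_min_natI[of good \<gamma>0 "\<lambda>\<gamma>. card (bad \<gamma>)"] arg_min_nat_le[of good _ "\<lambda>\<gamma>. card (bad \<gamma>)"]
    by metis
  have ex: "\<exists>y. y \<in> X \<and> a y \<noteq> b y \<and> a y = a x \<and> \<gamma> y = p x" if x: "x \<in> bad \<gamma>" for x
  proof -
    have xX: "x \<in> X" "a x = b x" "\<gamma> x \<noteq> p x" using x by (auto simp: bad_def)
    have "(\<lambda>x. (a x, \<gamma> x)) ` X = (\<lambda>x. (a x, p x)) ` X" using good by (simp add: good_def)
    then have "(a x, p x) \<in> (\<lambda>x. (a x, \<gamma> x)) ` X" using xX(1) by blast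
    then obtain y where y: "y \<in> X" "a y = a x" "\<gamma> y = p x" by auto
    have "a y \<noteq> b y"
    proof
      assume loop: "a y = b y"
      define t where "t = Transposition.transpose x y"
      define \<gamma>' where "\<gamma>' = \<gamma> \<circ> t"
      have tX: "bij_betw t X X" using xX y by (simp add: t_def bij_betw_transpose_iff)
      have at: "a (t z) = a z" "b (t z) = b z" for z
        using y xX loop by (auto simp: t_def Transposition.transpose_def)
      have eq: "(\<lambda>z. (a z, \<gamma>' z)) = (\<lambda>z. (a z, \<gamma> z)) \<circ> t" "(\<lambda>z. (b z, \<gamma>' z)) = (\<lambda>z. (b z, \<gamma> z)) \<circ> t"
        by (auto simp: \<gamma>'_def at)
      have "good \<gamma>'"
        using good tX unfolding good_def eq bij_betw_def image_comp[symmetric]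
        by (auto intro: comp_inj_on)
      then have "card (bad \<gamma>) \<le> card (bad \<gamma>')" by (rule min)
      moreover have "bad \<gamma>' \<subset> bad \<gamma>"
      proof -
        have "x \<notin> bad \<gamma>'" using y by (auto simp: bad_def \<gamma>'_def t_def)
        moreover have "z \<in> bad \<gamma>" if z: "z \<in> bad \<gamma>'" for z
        proof (cases "z = x \<or> z = y")
          case True
          then have zy: "z = y" using calculation z by auto
          \<comment> \<open>The exchange creates no new bad loop: \<open>y\<close> was bad before,
            because its colour was \<open>p x\<close>, and preferred colours at one vertex are
            distinct.\<close>
          have "p y \<noteq> p x" using pref y xX unfolding inj_on_def by (metis prod.inject)
          then show ?thesis using zy y loop by (auto simp: bad_def)
        next
          case False
          then show ?thesis using z by (auto simp: bad_def \<gamma>'_def t_def Transposition.transpose_def)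
        qed
        ultimately show ?thesis using x by blast
      qed
      then have "card (bad \<gamma>') < card (bad \<gamma>)"
        by (intro psubset_card_mono) (use assms in \<open>auto simp: bad_def\<close>)
      ultimately show False by simp
    qed
    then show ?thesis using y by blast
  qed
  then obtain g where g: "\<And>x. x \<in> bad \<gamma> \<Longrightarrow> g x \<in> X \<and> a (g x) \<noteq> b (g x) \<and> a (g x) = a x \<and> \<gamma> (g x) = p x"
    by metis
  \<comment> \<open>Each bad loop is charged to the non-loop that carries its preferred colour.
    Hence there are at most as many bad loops as non-loops, which gives the factor 2.\<close>
  have "inj_on g (bad \<gamma>)"
  proof (rule inj_onI)
    fix x y assume xy: "x \<in> bad \<gamma>" "y \<in> bad \<gamma>" "g x = g y"
    then have "a x = a y" "p x = p y" using g by metis+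
    then show "x = y" using pref xy unfolding inj_on_def bad_def by auto
  qed
  then have "card (bad \<gamma>) \<le> card {x \<in> X. a x \<noteq> b x}"
    by (rule card_inj_on_le) (use g assms in auto)
  moreover have "card {x \<in> X. \<gamma> x \<noteq> p x} \<le> card (bad \<gamma> \<union> {x \<in> X. a x \<noteq> b x})"
    by (rule card_mono) (use assms in \<open>auto simp: bad_def\<close>)
  moreover have "card (bad \<gamma> \<union> {x \<in> X. a x \<noteq> b x}) \<le> card (bad \<gamma>) + card {x \<in> X. a x \<noteq> b x}"
    by (rule card_Un_le)
  ultimately show ?thesis using good unfolding good_def by (intro exI[of _ \<gamma>]) auto
qed

text \<open>Arbitrary bijections between corresponding fibres are glued together. It is applied with
  \<open>a\<close> the block of a cube and \<open>b\<close> the block of its image.\<close>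

lemma relabelling_bijection:
  assumes "finite X" and "\<And>v. card {x \<in> X. a x = v} = card {x \<in> X. b x = v}"
  shows "\<exists>f. bij_betw f X X \<and> (\<forall>x\<in>X. a (f x) = b x)"
proof -
  have "\<exists>g. bij_betw g {x \<in> X. b x = v} {x \<in> X. a x = v}" for v
    by (rule finite_same_card_bij) (use assms in auto)
  then obtain g where g: "\<And>v. bij_betw (g v) {x \<in> X. b x = v} {x \<in> X. a x = v}" by metis
  define f where "f x = g (b x) x" for x
  have f: "f x \<in> X \<and> a (f x) = b x" if "x \<in> X" for x
    using g[of "b x"] that unfolding bij_betw_def f_def by blast
  have "inj_on f X"
  proof (rule inj_onI)
    fix x y assume xy: "x \<in> X" "y \<in> X" "f x = f y"
    then have "b x = b y" using f by metis
    then show "x = y" using g[of "b x"] xy unfolding bij_betw_def f_def inj_on_def by auto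
  qed
  moreover have "f ` X = X" using calculation f \<open>finite X\<close> by (intro endo_inj_surj) auto
  ultimately show ?thesis using f by (auto simp: bij_betw_def)
qed

section \<open>Lengths of flows and integer coordinates of cubes\<close>

lemma finite_small_sqrt_sums:
  fixes q L :: real
  assumes "q > 0"
  shows "finite {l. l \<le> L \<and> (\<exists>ns :: nat list. l = (\<Sum>n\<leftarrow>ns. q * sqrt (real n)))}" (is "finite ?S")
proof -
  define k where "k = nat \<lfloor>(L / q)\<^sup>2\<rfloor>"
  define m where "m = nat \<lfloor>L / q\<rfloor>"
  define F where "F = (\<lambda>ns. \<Sum>n\<leftarrow>ns. q * sqrt (real n))"
  have "?S \<subseteq> F ` {ns. set ns \<subseteq> {..k} \<and> length ns \<le> m}"
  proof
    fix l assume "l \<in> ?S"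
    then obtain ns where ns: "l = F ns" "l \<le> L" by (auto simp: F_def)
    define ms where "ms = filter (\<lambda>n. n \<noteq> 0) ns"
    have l: "l = F ms" unfolding ns F_def ms_def by (induction ns) auto
    have "q * real (length xs) \<le> F xs" if "0 \<notin> set xs" for xs
      using that
    proof (induction xs)
      case (Cons n xs)
      then have "q * 1 \<le> q * sqrt (real n)" using assms by (intro mult_left_mono) auto
      with Cons show ?case by (auto simp: F_def algebra_simps)
    qed (simp add: F_def)
    from this[of ms] have len: "real (length ms) \<le> L / q"
      using l ns(2) assms by (simp add: ms_def field_simps)
    have nonneg: "F xs \<ge> 0" for xs
      unfolding F_def using assms by (intro sum_list_nonneg) auto
    have "q * sqrt (real n) \<le> F xs" if "n \<in> set xs" for n xs
      using that
    proof (induction xs)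
      case (Cons a xs)
      then show ?case using nonneg[of xs] assms by (auto simp: F_def add_increasing)
    qed simp
    then have n: "sqrt (real n) \<le> L / q" if "n \<in> set ms" for n
      using \<open>\<And>xs n. n \<in> set xs \<Longrightarrow> q * sqrt (real n) \<le> F xs\<close>[OF that] l ns(2) assms
      by (simp add: field_simps)
    have "n \<le> k" if "n \<in> set ms" for n
    proof -
      have "real n \<le> (L / q)\<^sup>2" using power_mono[OF n[OF that], of 2] by simp
      then show ?thesis unfolding k_def by (simp add: le_nat_floor)
    qed
    moreover have "length ms \<le> m" using len unfolding m_def by (simp add: le_nat_floor)
    ultimately show "l \<in> F ` {ns. set ns \<subseteq> {..k} \<and> length ns \<le> m}" using l by auto
  qed
  then show ?thesis by (rule finite_subset) (intro finite_imageI finite_lists_length_le finite_atMost)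
qed

text \<open>The costs are \<open>q \<surd>n\<close> with natural \<open>n\<close>, so only finitely many lengths lie below a given one
  and the least length in the definition of the distance exists.\<close>

lemma flow_dist_le_flow_length:
  fixes P Q :: "real^'n::finite \<Rightarrow> real^'n" and Zs :: "'n movement list"
  assumes "N \<ge> 1" "discrete_flow N Zs" "connects N Zs P Q"
  shows "flow_dist N P Q \<le> flow_length N Zs"
proof -
  define S where "S = {l. \<exists>Zs :: 'n movement list. discrete_flow N Zs \<and> connects N Zs P Q \<and> l = flow_length N Zs}"
  define q where "q = real N powr (- 1 - real CARD('n) / 2)"
  define L where "L = flow_length N Zs"
  have q: "q > 0" using assms(1) by (simp add: q_def)
  have cost: "\<exists>n :: nat. movement_cost N Z = q * sqrt (real n)" for Z :: "'n movement"
  proof -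
    define a where "a = Max ((\<lambda>(A, p). array_length N A) ` set Z)"
    define b where "b = (\<Sum>(A, p)\<leftarrow>Z. num_couples p)"
    \<comment> \<open>The array length is an integer and can be taken under the root.\<close>
    have "movement_cost N Z = q * sqrt (real (a\<^sup>2 * b))"
      unfolding movement_cost_def a_def[symmetric] b_def[symmetric] q_def[symmetric]
      by (simp add: real_sqrt_mult)
    then show ?thesis by blast
  qed
  have "\<exists>ns :: nat list. flow_length N Ys = (\<Sum>n\<leftarrow>ns. q * sqrt (real n))" for Ys :: "'n movement list"
  proof (induction Ys)
    case Nil
    show ?case by (rule exI[of _ "[]"]) (simp add: flow_length_def)
  next
    case (Cons Z Ys)
    then obtain ns where "flow_length N Ys = (\<Sum>n\<leftarrow>ns. q * sqrt (real n))" by blast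
    moreover obtain n where "movement_cost N Z = q * sqrt (real n)" using cost by blast
    ultimately show ?case by (intro exI[of _ "n # ns"]) (simp add: flow_length_def)
  qed
  then have "{l \<in> S. l \<le> L} \<subseteq> {l. l \<le> L \<and> (\<exists>ns :: nat list. l = (\<Sum>n\<leftarrow>ns. q * sqrt (real n)))}"
    unfolding S_def by blast
  then have fin: "finite {l \<in> S. l \<le> L}" using finite_small_sqrt_sums[OF q] by (rule finite_subset)
  have LS: "L \<in> {l \<in> S. l \<le> L}" unfolding S_def L_def using assms by blast
  define l0 where "l0 = Min {l \<in> S. l \<le> L}"
  have l0: "l0 \<in> {l \<in> S. l \<le> L}" unfolding l0_def using fin LS Min_in by blast
  have least: "l0 \<le> l" if "l \<in> S" for l
  proof (cases "l \<le> L")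
    case True
    then show ?thesis using fin that unfolding l0_def by (intro Min_le) auto
  next
    case False
    then show ?thesis using l0 by simp
  qed
  have "flow_dist N P Q = l0"
    unfolding flow_dist_def by (rule Least_equality) (use l0 least in \<open>auto simp: S_def\<close>)
  then show ?thesis using l0 by (simp add: L_def)
qed

text \<open>A cube is encoded by the integer coordinates of its lowest corner.\<close>

definition cells :: "nat \<Rightarrow> ('n::finite \<Rightarrow> nat) set" where
  "cells N = {c. \<forall>i. c i < N}"

definition cell_vec :: "('n::finite \<Rightarrow> nat) \<Rightarrow> real^'n" where
  "cell_vec c = (\<chi> i. real (c i))"

definition cube :: "nat \<Rightarrow> ('n::finite \<Rightarrow> nat) \<Rightarrow> (real^'n) set" where
  "cube N c = rectangle N (\<chi> i. c i) ((\<chi> i. c i) + 1)"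

lemma cells_eq_PiE: "cells N = (UNIV :: 'n::finite set) \<rightarrow>\<^sub>E {..<N}"
  by (auto simp: cells_def PiE_UNIV_domain)

lemma finite_cells [simp, intro]: "finite (cells N :: ('n::finite \<Rightarrow> nat) set)"
  unfolding cells_eq_PiE by (intro finite_PiE) auto

lemma card_cells: "card (cells N :: ('n::finite \<Rightarrow> nat) set) = N ^ CARD('n)"
  unfolding cells_eq_PiE by (simp add: card_PiE)

lemma cells_upd: "c \<in> cells N \<Longrightarrow> x < N \<Longrightarrow> c(i := x) \<in> cells N"
  by (auto simp: cells_def)

lemma mem_interior_rectangle:
  "x \<in> interior (rectangle N h h') \<longleftrightarrow> (\<forall>i. real (h $ i) / real N < x $ i \<and> x $ i < real (h' $ i) / real N)"
  by (auto simp: rectangle_def mem_box_cart interior_cbox)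

lemma mem_interior_cube:
  "x \<in> interior (cube N c) \<longleftrightarrow> (\<forall>i. real (c i) / real N < x $ i \<and> x $ i < (real (c i) + 1) / real N)"
  by (simp add: cube_def mem_interior_rectangle add.commute)

lemma interior_cube_floor:
  assumes "N \<ge> 1" "real k / real N < y" "y < real (Suc k) / real N"
  shows "nat \<lfloor>y * real N\<rfloor> = k"
proof -
  have "\<lfloor>y * real N\<rfloor> = int k" using assms by (intro floor_unique) (auto simp: field_simps)
  then show ?thesis by simp
qed

lemma interior_cube_disjoint:
  assumes "N \<ge> 1" "x \<in> interior (cube N c)" "x \<in> interior (cube N d)"
  shows "c = d"
proof
  fix i
  show "c i = d i"
    using interior_cube_floor[OF assms(1), of "c i" "x $ i"] interior_cube_floor[OF assms(1), of "d i" "x $ i"]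
      assms(2,3) by (simp add: mem_interior_cube add.commute)
qed

lemma interior_cube_shift:
  assumes "N \<ge> 1" "x \<in> interior (cube N c)"
  shows "x + (cell_vec d - cell_vec c) /\<^sub>R real N \<in> interior (cube N d)"
  using assms by (simp add: mem_interior_cube cell_vec_def divide_inverse algebra_simps)

lemma tiling_eq: "tiling N = cube N ` (cells N :: ('n::finite \<Rightarrow> nat) set)"
proof (intro set_eqI iffI)
  fix \<kappa> :: "(real^'n) set"
  assume "\<kappa> \<in> tiling N"
  then obtain h where h: "\<kappa> = rectangle N h (h + 1)" "is_rectangle N h (h + 1)"
    unfolding tiling_def by blast
  have "\<kappa> = cube N (\<lambda>i. h $ i)" unfolding h cube_def vec_lambda_eta ..
  moreover have "(\<lambda>i. h $ i) \<in> cells N" using h(2) by (simp add: is_rectangle_def cells_def Suc_le_eq)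
  ultimately show "\<kappa> \<in> cube N ` cells N" by blast
next
  fix \<kappa> :: "(real^'n) set"
  assume "\<kappa> \<in> cube N ` cells N"
  then obtain c where c: "\<kappa> = cube N c" "c \<in> cells N" by blast
  then have "is_rectangle N (\<chi> i. c i) ((\<chi> i. c i) + 1)"
    by (simp add: is_rectangle_def cells_def Suc_le_eq)
  then show "\<kappa> \<in> tiling N" unfolding tiling_def c cube_def by blast
qed

lemma interval_bounds_rectangle:
  assumes "\<forall>i. h $ i \<le> h' $ i"
  shows "interval_lowerbound (rectangle N h h') = (\<chi> i. real (h $ i) / real N)"
    "interval_upperbound (rectangle N h h') = (\<chi> i. real (h' $ i) / real N)"
  unfolding rectangle_def using assms
  by (auto simp: Basis_vec_def inner_axis intro!: interval_lowerbound interval_upperbound divide_right_mono)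

lemma center_cube_diff:
  "center (cube N d) - center (cube N c) = (cell_vec d - cell_vec c) /\<^sub>R real N"
  unfolding center_def cube_def
  by (simp add: interval_bounds_rectangle midpoint_def vec_eq_iff cell_vec_def field_simps add_divide_distrib)

lemma inj_cube:
  fixes c d :: "'n::finite \<Rightarrow> nat"
  assumes "N \<ge> 1" "cube N c = cube N d"
  shows "c = d"
proof
  fix i
  have lb: "interval_lowerbound (cube N e) $ i = real (e i) / real N" for e :: "'n \<Rightarrow> nat"
    unfolding cube_def by (subst interval_bounds_rectangle(1)) auto
  show "c i = d i" using lb[of c] lb[of d] assms by simp
qed

text \<open>Only interiors are constrained, because representatives of permutations are arbitrary on
  the faces. The same relation thus covers members of \<open>cube_perms\<close> and compositions of
  swaps, and both become maps of integer vectors.\<close>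

definition acts :: "nat \<Rightarrow> (real^'n::finite \<Rightarrow> real^'n) \<Rightarrow> (('n \<Rightarrow> nat) \<Rightarrow> ('n \<Rightarrow> nat)) \<Rightarrow> bool" where
  "acts N g f \<longleftrightarrow> (\<forall>c\<in>cells N. f c \<in> cells N \<and>
     (\<forall>x\<in>interior (cube N c). g x = x + (cell_vec (f c) - cell_vec c) /\<^sub>R real N))"

lemma acts_cong: "acts N g f \<Longrightarrow> (\<And>c. c \<in> cells N \<Longrightarrow> f c = f' c) \<Longrightarrow> acts N g f'"
  by (simp add: acts_def)

lemma acts_comp:
  fixes f f' :: "('n::finite \<Rightarrow> nat) \<Rightarrow> ('n \<Rightarrow> nat)"
  assumes "N \<ge> 1" "acts N g f" "acts N g' f'"
  shows "acts N (\<lambda>x. g' (g x)) (\<lambda>c. f' (f c))"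
  unfolding acts_def
proof (intro ballI conjI)
  fix c :: "'n \<Rightarrow> nat" assume c: "c \<in> cells N"
  then show "f' (f c) \<in> cells N" using assms by (auto simp: acts_def)
  fix x assume x: "x \<in> interior (cube N c)"
  have gx: "g x = x + (cell_vec (f c) - cell_vec c) /\<^sub>R real N" using assms c x by (simp add: acts_def)
  have "g x \<in> interior (cube N (f c))" unfolding gx using assms(1) x by (rule interior_cube_shift)
  then have "g' (g x) = g x + (cell_vec (f' (f c)) - cell_vec (f c)) /\<^sub>R real N"
    using assms c by (simp add: acts_def)
  then show "g' (g x) = x + (cell_vec (f' (f c)) - cell_vec c) /\<^sub>R real N"
    by (simp add: gx algebra_simps)
qed

lemma acts_swap_cubes:
  fixes a b :: "'n::finite \<Rightarrow> nat"
  assumes "N \<ge> 1" "a \<in> cells N" "b \<in> cells N"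
  shows "acts N (swap_cubes (cube N a, cube N b)) (Transposition.transpose a b)"
  unfolding acts_def
proof (intro ballI conjI)
  fix c :: "'n \<Rightarrow> nat" assume c: "c \<in> cells N"
  then show "Transposition.transpose a b c \<in> cells N" using assms by (auto simp: Transposition.transpose_def)
  fix x assume x: "x \<in> interior (cube N c)"
  have iff: "x \<in> interior (cube N d) \<longleftrightarrow> d = c" for d
    using x interior_cube_disjoint[OF assms(1)] by blast
  show "swap_cubes (cube N a, cube N b) x = x + (cell_vec (Transposition.transpose a b c) - cell_vec c) /\<^sub>R real N"
    by (auto simp: swap_cubes_def iff Transposition.transpose_def center_cube_diff add_diff_eq[symmetric] simp del: scaleR_right_diff_distrib)
qed

lemma acts_fold_swap_cubes:
  assumes "N \<ge> 1" "\<forall>(a, b)\<in>set cs. a \<in> cells N \<and> b \<in> cells N"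
  shows "acts N (fold swap_cubes (map (map_prod (cube N) (cube N)) cs))
    (fold (\<lambda>(a, b). Transposition.transpose a b) cs)"
  using assms(2)
proof (induction cs)
  case Nil
  then show ?case by (simp add: acts_def)
next
  case (Cons ab cs)
  obtain a b where ab: "ab = (a, b)" by force
  show ?case
    using acts_comp[OF assms(1) acts_swap_cubes[OF assms(1), of a b] Cons.IH] Cons.prems
    by (simp add: ab comp_def)
qed

text \<open>An upper bound \<open>L\<close> replaces the exact length so that estimates can be added
  along compositions and weakened freely.\<close>

definition reaches :: "nat \<Rightarrow> (('n::finite \<Rightarrow> nat) \<Rightarrow> ('n \<Rightarrow> nat)) \<Rightarrow> real \<Rightarrow> bool" where
  "reaches N f L \<longleftrightarrow> (\<exists>Zs :: 'n movement list. discrete_flow N Zs \<and> flow_length N Zs \<le> L \<and>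
     acts N (fold (movement_map N) Zs) f)"

lemma reaches_comp:
  assumes "N \<ge> 1" "reaches N f L" "reaches N f' L'"
  shows "reaches N (\<lambda>c. f' (f c)) (L + L')"
proof -
  obtain Zs where Zs: "discrete_flow N Zs" "flow_length N Zs \<le> L" "acts N (fold (movement_map N) Zs) f"
    using assms by (auto simp: reaches_def)
  obtain Zs' where Zs': "discrete_flow N Zs'" "flow_length N Zs' \<le> L'" "acts N (fold (movement_map N) Zs') f'"
    using assms by (auto simp: reaches_def)
  have "discrete_flow N (Zs @ Zs')" "flow_length N (Zs @ Zs') \<le> L + L'"
    using Zs Zs' by (auto simp: discrete_flow_def flow_length_def)
  moreover have "acts N (fold (movement_map N) (Zs @ Zs')) (\<lambda>c. f' (f c))"
    using acts_comp[OF assms(1) Zs(3) Zs'(3)] by (simp add: comp_def)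
  ultimately show ?thesis unfolding reaches_def by blast
qed

lemma reaches_id:
  assumes "\<And>c. c \<in> cells N \<Longrightarrow> f c = c"
  shows "reaches N f 0"
  unfolding reaches_def
  by (rule exI[of _ "[]"]) (use assms in \<open>simp add: discrete_flow_def flow_length_def acts_def\<close>)

lemma reaches_cong: "reaches N f L \<Longrightarrow> (\<And>c. c \<in> cells N \<Longrightarrow> f c = f' c) \<Longrightarrow> L \<le> L' \<Longrightarrow> reaches N f' L'"
  unfolding reaches_def by (meson acts_cong order_trans)

section \<open>Simultaneous nested swaps\<close>

lemma sorted_wrt_distinct:
  assumes "distinct xs" "\<And>x y. x \<in> set xs \<Longrightarrow> y \<in> set xs \<Longrightarrow> x \<noteq> y \<Longrightarrow> R x y"
  shows "sorted_wrt R xs"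
  using assms by (induction xs) auto

lemma sorted_wrt_concat:
  assumes "\<And>xs. xs \<in> set xss \<Longrightarrow> sorted_wrt R xs"
    and "sorted_wrt (\<lambda>xs ys. \<forall>x\<in>set xs. \<forall>y\<in>set ys. R x y) xss"
  shows "sorted_wrt R (concat xss)"
  using assms by (induction xss) (auto simp: sorted_wrt_append)

lemma fold_transpose_disjoint:
  fixes cs :: "('a \<times> 'a) list"
  assumes "sorted_wrt (\<lambda>(a, b) (c, d). {a, b} \<inter> {c, d} = {}) cs"
  shows "(a, b) \<in> set cs \<Longrightarrow> fold (\<lambda>(a, b). Transposition.transpose a b) cs a = b \<and>
      fold (\<lambda>(a, b). Transposition.transpose a b) cs b = a"
    and "\<forall>(a, b)\<in>set cs. c \<noteq> a \<and> c \<noteq> b \<Longrightarrow> fold (\<lambda>(a, b). Transposition.transpose a b) cs c = c"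
proof -
  show fixed: "fold (\<lambda>(a, b). Transposition.transpose a b) cs c = c"
    if "\<forall>(a, b)\<in>set cs. c \<noteq> a \<and> c \<noteq> b" for c and cs :: "('a \<times> 'a) list"
    using that by (induction cs) auto
  show "fold (\<lambda>(a, b). Transposition.transpose a b) cs a = b \<and>
      fold (\<lambda>(a, b). Transposition.transpose a b) cs b = a" if "(a, b) \<in> set cs"
    using assms that
  proof (induction cs)
    case (Cons p cs)
    obtain c d where p: "p = (c, d)" by force
    show ?case
    proof (cases "(a, b) \<in> set cs")
      case True
      then have "a \<noteq> c" "a \<noteq> d" "b \<noteq> c" "b \<noteq> d" using Cons.prems(1) by (auto simp: p)
      then show ?thesis using Cons True by (simp add: p)
    next
      case False
      then have ab: "p = (a, b)" using Cons.prems by simp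
      then have "\<forall>(c, d)\<in>set cs. a \<noteq> c \<and> a \<noteq> d" "\<forall>(c, d)\<in>set cs. b \<noteq> c \<and> b \<noteq> d"
        using Cons.prems(1) by auto
      then show ?thesis by (simp add: ab fixed)
    qed
  qed simp
qed

text \<open>The entry \<open>v i\<close> is overwritten, so a segment has several names; quicksort
  below fixes \<open>v i = 0\<close> to make the name unique. \<open>segment\<close> is the same
  array as a set of integer vectors.\<close>

definition segment_array :: "'n::finite \<Rightarrow> ('n \<Rightarrow> nat) \<times> nat \<times> nat \<Rightarrow> 'n array" where
  "segment_array i = (\<lambda>(v, lo, hi). Array i (\<chi> j. (v(i := lo)) j) (\<chi> j. if j = i then hi else v j + 1))"

definition segment :: "'n::finite \<Rightarrow> ('n \<Rightarrow> nat) \<times> nat \<times> nat \<Rightarrow> ('n \<Rightarrow> nat) set" where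
  "segment i = (\<lambda>(v, lo, hi). (\<lambda>x. v(i := x)) ` {lo..<hi})"

lemma is_array_segment:
  assumes "v \<in> cells N" "lo < hi" "hi \<le> N"
  shows "is_array N (segment_array i (v, lo, hi))"
  using assms by (auto simp: is_array_def segment_array_def is_rectangle_def cells_def Suc_le_eq)

lemma cube_subset_segment:
  assumes "N \<ge> 1" "lo < hi"
  shows "cube N c \<subseteq> array_set N (segment_array i (v, lo, hi)) \<longleftrightarrow> c \<in> segment i (v, lo, hi)"
proof -
  have Suc_real: "1 + real m \<le> real n \<longleftrightarrow> Suc m \<le> n" for m n by linarith
  have "cube N c \<subseteq> array_set N (segment_array i (v, lo, hi)) \<longleftrightarrow>
    (\<forall>j. (v(i := lo)) j \<le> c j \<and> c j + 1 \<le> (if j = i then hi else v j + 1))"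
    using assms Suc_real unfolding cube_def array_set_def segment_array_def rectangle_def
    by (simp add: subset_interval_cart divide_right_mono divide_le_cancel)
  also have "\<dots> \<longleftrightarrow> c \<in> segment i (v, lo, hi)"
  proof
    assume L: "\<forall>j. (v(i := lo)) j \<le> c j \<and> c j + 1 \<le> (if j = i then hi else v j + 1)"
    have "c j = v j" if "j \<noteq> i" for j using L[rule_format, of j] that by simp
    then have "c = v(i := c i)" by auto
    moreover have "c i \<in> {lo..<hi}" using L[rule_format, of i] by simp
    ultimately show "c \<in> segment i (v, lo, hi)" unfolding segment_def by force
  qed (auto simp: segment_def)
  finally show ?thesis .
qed

lemma array_length_segment:
  assumes "N \<ge> 1" "v \<in> cells N" "lo < hi" "hi \<le> N"
  shows "array_length N (segment_array i (v, lo, hi)) = hi - lo"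
proof -
  have sub: "segment i (v, lo, hi) \<subseteq> cells N" using assms by (auto simp: segment_def cells_def)
  have "{\<kappa> \<in> tiling N. \<kappa> \<subseteq> array_set N (segment_array i (v, lo, hi))} = cube N ` segment i (v, lo, hi)"
  proof -
    have "{\<kappa> \<in> tiling N. \<kappa> \<subseteq> array_set N (segment_array i (v, lo, hi))} =
      cube N ` {c \<in> cells N. cube N c \<subseteq> array_set N (segment_array i (v, lo, hi))}"
      unfolding tiling_eq by blast
    also have "{c \<in> cells N. cube N c \<subseteq> array_set N (segment_array i (v, lo, hi))} = segment i (v, lo, hi)"
      unfolding cube_subset_segment[OF assms(1,3)] using sub by blast
    finally show ?thesis .
  qed
  moreover have "inj_on (cube N) (segment i (v, lo, hi))"
    by (rule inj_onI) (rule inj_cube[OF assms(1)])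
  moreover have "inj_on (\<lambda>x. v(i := x)) {lo..<hi}" by (auto intro!: inj_onI dest: fun_upd_eqD)
  ultimately show ?thesis by (simp add: array_length_def card_image segment_def)
qed

lemma array_cube_segment:
  assumes "lo \<le> x"
  shows "array_cube N (segment_array i (v, lo, hi)) (Suc (x - lo)) = cube N (v(i := x))"
proof -
  have "(\<chi> j. (v(i := lo)) j) + axis i (x - lo) = (\<chi> j. (v(i := x)) j)"
    using assms by (simp add: vec_eq_iff axis_def)
  then show ?thesis by (simp add: array_cube_def segment_array_def cube_def Let_def)
qed

text \<open>A common interior point determines the coordinates in the directions other than
  \<open>i\<close>. In direction \<open>i\<close> it may lie on a face between two cubes, but
  rounding down still gives an index in both ranges.\<close>

lemma interior_segments_disjoint:
  assumes "N \<ge> 1" "segment i (v, lo, hi) \<inter> segment i (v', lo', hi') = {}"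
  shows "interior (array_set N (segment_array i (v, lo, hi))) \<inter>
    interior (array_set N (segment_array i (v', lo', hi'))) = {}"
proof (rule ccontr)
  assume "\<not> ?thesis"
  then obtain x where "x \<in> interior (array_set N (segment_array i (v, lo, hi)))"
    "x \<in> interior (array_set N (segment_array i (v', lo', hi')))" by blast
  then have x: "\<forall>j. real ((v(i := lo)) j) / real N < x $ j \<and> x $ j < real (if j = i then hi else v j + 1) / real N"
    "\<forall>j. real ((v'(i := lo')) j) / real N < x $ j \<and> x $ j < real (if j = i then hi' else v' j + 1) / real N"
    by (simp_all add: array_set_def segment_array_def mem_interior_rectangle)
  have eq: "v j = v' j" if "j \<noteq> i" for j
    using interior_cube_floor[OF assms(1), of "v j" "x $ j"] interior_cube_floor[OF assms(1), of "v' j" "x $ j"]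
      x(1)[rule_format, of j] x(2)[rule_format, of j] that by simp
  define k where "k = nat \<lfloor>x $ i * real N\<rfloor>"
  have k: "k \<in> {l..<h}" if "real l / real N < x $ i" "x $ i < real h / real N" for l h
  proof -
    have "real l < x $ i * real N" "x $ i * real N < real h" using that assms(1) by (auto simp: field_simps)
    then show ?thesis unfolding k_def by (auto simp: le_nat_floor nat_less_iff floor_less_iff)
  qed
  have "k \<in> {lo..<hi}" "k \<in> {lo'..<hi'}"
    using k[of lo hi] k[of lo' hi'] x(1)[rule_format, of i] x(2)[rule_format, of i] by auto
  then have "v(i := k) \<in> segment i (v, lo, hi)" "v'(i := k) \<in> segment i (v', lo', hi')"
    unfolding segment_def by auto
  moreover have "v(i := k) = v'(i := k)" using eq by auto
  ultimately show False using assms(2) by auto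
qed

text \<open>Running through \<open>U\<close> upwards and through \<open>V\<close> downwards yields
  exactly the nesting that \<open>couples\<close> prescribes, once \<open>U\<close> lies to the left
  of \<open>V\<close>.\<close>

definition swap_pairs :: "'n::finite \<Rightarrow> ('n \<Rightarrow> nat) \<Rightarrow> nat set \<Rightarrow> nat set \<Rightarrow> (('n \<Rightarrow> nat) \<times> ('n \<Rightarrow> nat)) list" where
  "swap_pairs i v U V = map (\<lambda>(x, y). (v(i := x), v(i := y)))
     (zip (sorted_list_of_set U) (rev (sorted_list_of_set V)))"

text \<open>Cubes of an array are numbered from 1, whence the \<open>Suc\<close>. The first half of
  the index list comes from \<open>U\<close>, the second from \<open>V\<close>.\<close>

definition swap_indices :: "nat \<Rightarrow> nat set \<Rightarrow> nat set \<Rightarrow> nat list" where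
  "swap_indices lo U V = map (\<lambda>x. Suc (x - lo)) (sorted_list_of_set U @ sorted_list_of_set V)"

lemma num_couples_swap_indices:
  assumes "card U = card V"
  shows "num_couples (swap_indices lo U V) = card U"
  using assms by (simp add: num_couples_def swap_indices_def)

lemma couples_segment:
  assumes "finite U" "finite V" "card U = card V" "U \<subseteq> {lo..}" "V \<subseteq> {lo..}"
  shows "couples N (segment_array i (v, lo, hi), swap_indices lo U V) =
    map (map_prod (cube N) (cube N)) (swap_pairs i v U V)"
proof (rule nth_equalityI)
  show "length (couples N (segment_array i (v, lo, hi), swap_indices lo U V)) =
    length (map (map_prod (cube N) (cube N)) (swap_pairs i v U V))"
    using assms by (simp add: couples_def num_couples_swap_indices swap_pairs_def del: upt_Suc)
next
  fix k assume "k < length (couples N (segment_array i (v, lo, hi), swap_indices lo U V))"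
  then have k: "k < card U"
    using assms by (simp add: couples_def num_couples_swap_indices del: upt_Suc)
  define lU where "lU = sorted_list_of_set U"
  define lV where "lV = sorted_list_of_set V"
  have len: "length lU = card U" "length lV = card U" using assms by (auto simp: lU_def lV_def)
  have mem: "lU ! k \<in> U" "lV ! (card U - Suc k) \<in> V"
    using k len assms nth_mem[of k lU] nth_mem[of "card U - Suc k" lV] by (auto simp: lU_def lV_def)
  then have lo: "lo \<le> lU ! k" "lo \<le> lV ! (card U - Suc k)" using assms by auto
  \<comment> \<open>The second index of the couple \<open>j = Suc k\<close> is at position
    \<open>2 * h - j\<close>, which lies in the half of the list that comes from \<open>V\<close>,
    at offset \<open>card U - Suc k\<close>.\<close>
  have idx: "2 * card U - Suc k = card U + (card U - Suc k)" using k by simp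
  have p1: "swap_indices lo U V ! k = Suc (lU ! k - lo)"
    using k len by (simp add: swap_indices_def lU_def[symmetric] lV_def[symmetric] nth_append)
  have p2: "swap_indices lo U V ! (2 * card U - Suc k) = Suc (lV ! (card U - Suc k) - lo)"
    unfolding idx using k len
    by (simp add: swap_indices_def lU_def[symmetric] lV_def[symmetric] nth_append)
  have "couples N (segment_array i (v, lo, hi), swap_indices lo U V) ! k =
    (cube N (v(i := lU ! k)), cube N (v(i := lV ! (card U - Suc k))))"
    using k assms(3) p1 p2 lo by (simp add: couples_def num_couples_swap_indices array_cube_segment del: upt_Suc)
  also have "\<dots> = map (map_prod (cube N) (cube N)) (swap_pairs i v U V) ! k"
    using k len by (simp add: swap_pairs_def lU_def[symmetric] lV_def[symmetric] rev_nth)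
  finally show "couples N (segment_array i (v, lo, hi), swap_indices lo U V) ! k =
    map (map_prod (cube N) (cube N)) (swap_pairs i v U V) ! k" .
qed

lemma is_swap_seq_swap_indices:
  assumes "N \<ge> 1" "v \<in> cells N" "lo < hi" "hi \<le> N"
    and "U \<subseteq> {lo..<hi}" "V \<subseteq> {lo..<hi}" "card U = card V" "\<And>x y. x \<in> U \<Longrightarrow> y \<in> V \<Longrightarrow> x < y"
  shows "is_swap_seq N (segment_array i (v, lo, hi)) (swap_indices lo U V)"
proof -
  have fin: "finite U" "finite V" using assms finite_subset by blast+
  have lo: "\<forall>x\<in>U \<union> V. lo \<le> x" using assms(5,6) by auto
  have "sorted_wrt (<) (sorted_list_of_set U @ sorted_list_of_set V)"
    using fin assms(8) by (auto simp: sorted_wrt_append)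
  then have "sorted_wrt (\<lambda>x y. Suc (x - lo) < Suc (y - lo)) (sorted_list_of_set U @ sorted_list_of_set V)"
    by (rule sorted_wrt_mono_rel[rotated]) (use lo fin in \<open>auto intro!: diff_less_mono\<close>)
  then have "sorted_wrt (<) (swap_indices lo U V)" by (simp add: swap_indices_def sorted_wrt_map del: map_append)
  moreover have "set (swap_indices lo U V) \<subseteq> {1..hi - lo}"
    using assms fin by (fastforce simp: swap_indices_def)
  ultimately show ?thesis
    using assms by (simp add: is_swap_seq_def array_length_segment) (simp add: swap_indices_def)
qed

lemma swap_pairs_disjoint:
  assumes "finite U" "finite V" "U \<inter> V = {}"
  shows "sorted_wrt (\<lambda>(a, b) (c, d). {a, b} \<inter> {c, d} = {}) (swap_pairs i v U V)"
proof -
  have "sorted_wrt (\<lambda>(x, y) (x', y'). {x, y} \<inter> {x', y'} = {}) (zip (sorted_list_of_set U) (rev (sorted_list_of_set V)))"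
  proof (unfold sorted_wrt_iff_nth_less, intro allI impI, goal_cases)
    case (1 j k)
    define lU where "lU = sorted_list_of_set U"
    define lV where "lV = rev (sorted_list_of_set V)"
    have d: "distinct lU" "distinct lV" "set lU = U" "set lV = V" using assms by (auto simp: lU_def lV_def)
    have jk: "j < length lU" "j < length lV" "k < length lU" "k < length lV" "j \<noteq> k"
      using 1 by (auto simp: lU_def lV_def)
    have mem: "lU ! j \<in> U" "lU ! k \<in> U" "lV ! j \<in> V" "lV ! k \<in> V"
      using jk nth_mem[of j lU] nth_mem[of k lU] nth_mem[of j lV] nth_mem[of k lV] d(3,4) by auto
    have neq: "lU ! j \<noteq> lU ! k" "lV ! j \<noteq> lV ! k" using d jk by (auto simp: nth_eq_iff_index_eq)
    have "lU ! j \<noteq> lV ! k" "lV ! j \<noteq> lU ! k" using mem assms(3) by auto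
    then have "{lU ! j, lV ! j} \<inter> {lU ! k, lV ! k} = {}" using neq by auto
    then show ?case using jk unfolding lU_def[symmetric] lV_def[symmetric] by simp
  qed
  then show ?thesis unfolding swap_pairs_def sorted_wrt_map
    by (rule sorted_wrt_mono_rel[rotated]) (auto dest: fun_upd_eqD)
qed

lemma set_swap_pairs:
  assumes "finite U" "finite V" "card U = card V"
  shows "(a, b) \<in> set (swap_pairs i v U V) \<Longrightarrow> \<exists>x\<in>U. \<exists>y\<in>V. a = v(i := x) \<and> b = v(i := y)"
    and "x \<in> U \<Longrightarrow> \<exists>y\<in>V. (v(i := x), v(i := y)) \<in> set (swap_pairs i v U V)"
    and "y \<in> V \<Longrightarrow> \<exists>x\<in>U. (v(i := x), v(i := y)) \<in> set (swap_pairs i v U V)"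
proof -
  define lU where "lU = sorted_list_of_set U"
  define lV where "lV = rev (sorted_list_of_set V)"
  have d: "set lU = U" "set lV = V" "length lU = card U" "length lV = card U"
    using assms by (auto simp: lU_def lV_def)
  have sp: "swap_pairs i v U V = map (\<lambda>(x, y). (v(i := x), v(i := y))) (zip lU lV)"
    by (simp add: swap_pairs_def lU_def lV_def)
  show "\<exists>x\<in>U. \<exists>y\<in>V. a = v(i := x) \<and> b = v(i := y)" if "(a, b) \<in> set (swap_pairs i v U V)"
    using that d unfolding sp by (auto dest: set_zip_leftD set_zip_rightD)
  show "\<exists>y\<in>V. (v(i := x), v(i := y)) \<in> set (swap_pairs i v U V)" if "x \<in> U"
  proof -
    have "x \<in> set lU" using that d by simp
    then obtain k where "k < length lU" "lU ! k = x" unfolding in_set_conv_nth by blast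
    then have k: "k < card U" "lU ! k = x" using d by auto
    then have "(x, lV ! k) \<in> set (zip lU lV)" "lV ! k \<in> V"
      using d nth_mem[of k lV] by (auto simp: set_zip)
    then show ?thesis unfolding sp by force
  qed
  show "\<exists>x\<in>U. (v(i := x), v(i := y)) \<in> set (swap_pairs i v U V)" if "y \<in> V"
  proof -
    have "y \<in> set lV" using that d by simp
    then obtain k where "k < length lV" "lV ! k = y" unfolding in_set_conv_nth by blast
    then have k: "k < card U" "lV ! k = y" using d by auto
    then have "(lU ! k, y) \<in> set (zip lU lV)" "lU ! k \<in> U"
      using d nth_mem[of k lU] by (auto simp: set_zip)
    then show ?thesis unfolding sp by force
  qed
qed

text \<open>One movement with one array for each element of \<open>B\<close>. Which cell of
  \<open>V b\<close> is the partner of a cell of \<open>U b\<close> is left open: quicksort only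
  needs to know that the two sets are exchanged.\<close>

lemma reaches_simultaneous_swaps:
  fixes i :: "'n::finite" and B :: "(('n \<Rightarrow> nat) \<times> nat \<times> nat) set"
  assumes N: "N \<ge> 1" and B: "finite B" "B \<noteq> {}"
    and seg: "\<And>v lo hi. (v, lo, hi) \<in> B \<Longrightarrow> v \<in> cells N \<and> lo < hi \<and> hi \<le> N \<and> hi - lo \<le> l"
    and disj: "\<And>b b'. b \<in> B \<Longrightarrow> b' \<in> B \<Longrightarrow> b \<noteq> b' \<Longrightarrow> segment i b \<inter> segment i b' = {}"
    and UV: "\<And>v lo hi. (v, lo, hi) \<in> B \<Longrightarrow> U (v, lo, hi) \<subseteq> {lo..<hi} \<and> V (v, lo, hi) \<subseteq> {lo..<hi} \<and>
      card (U (v, lo, hi)) = card (V (v, lo, hi)) \<and> (\<forall>x\<in>U (v, lo, hi). \<forall>y\<in>V (v, lo, hi). x < y)"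
  shows "\<exists>z. reaches N z (real l * real N powr (- 1 - real CARD('n) / 2) * sqrt (real (\<Sum>b\<in>B. card (U b)))) \<and>
    (\<forall>b\<in>B. \<forall>x\<in>U b. \<exists>y\<in>V b. z ((fst b)(i := x)) = (fst b)(i := y) \<and> z ((fst b)(i := y)) = (fst b)(i := x)) \<and>
    (\<forall>b\<in>B. \<forall>y\<in>V b. \<exists>x\<in>U b. z ((fst b)(i := x)) = (fst b)(i := y) \<and> z ((fst b)(i := y)) = (fst b)(i := x)) \<and>
    (\<forall>c. (\<forall>b\<in>B. \<forall>x\<in>U b \<union> V b. c \<noteq> (fst b)(i := x)) \<longrightarrow> z c = c)"
proof -
  obtain bs where bs: "set bs = B" "distinct bs" using finite_distinct_list[OF B(1)] by blast
  define P where "P b = swap_pairs i (fst b) (U b) (V b)" for b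
  define Z :: "'n movement" where "Z = map (\<lambda>b. (segment_array i b, swap_indices (fst (snd b)) (U b) (V b))) bs"
  define cs where "cs = concat (map P bs)"
  define z where "z = fold (\<lambda>(a, b). Transposition.transpose a b) cs"
  have finUV: "finite (U b)" "finite (V b)" "card (U b) = card (V b)" "U b \<inter> V b = {}" if "b \<in> B" for b
  proof -
    obtain v lo hi where b: "b = (v, lo, hi)" by (cases b)
    show "finite (U b)" "finite (V b)" "card (U b) = card (V b)"
      using UV[of v lo hi] that finite_subset unfolding b by blast+
    show "U b \<inter> V b = {}" using UV[of v lo hi] that unfolding b by fastforce
  qed
  have Pseg: "a \<in> segment i b \<and> a' \<in> segment i b" if b: "b \<in> B" and P: "(a, a') \<in> set (P b)" for a a' b
  proof -
    obtain v lo hi where b': "b = (v, lo, hi)" by (cases b)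
    have "\<exists>x\<in>U b. \<exists>y\<in>V b. a = v(i := x) \<and> a' = v(i := y)"
      using set_swap_pairs(1)[of "U b" "V b" a a' i v] finUV[OF b] P unfolding P_def b' by simp
    then show ?thesis using UV[of v lo hi] b unfolding b' segment_def by blast
  qed
  have segc: "segment i b \<subseteq> cells N" if b: "b \<in> B" for b
  proof -
    obtain v lo hi where b': "b = (v, lo, hi)" by (cases b)
    show ?thesis using seg[of v lo hi] b unfolding b' segment_def by (auto intro: cells_upd)
  qed
  have sorted: "sorted_wrt (\<lambda>(a, b) (c, d). {a, b} \<inter> {c, d} = {}) cs"
    unfolding cs_def
  proof (rule sorted_wrt_concat)
    show "sorted_wrt (\<lambda>(a, b) (c, d). {a, b} \<inter> {c, d} = {}) xs" if xs: "xs \<in> set (map P bs)" for xs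
    proof -
      obtain b where b: "b \<in> B" "xs = P b" using xs bs by auto
      show ?thesis unfolding b P_def by (rule swap_pairs_disjoint) (use finUV b in auto)
    qed
    show "sorted_wrt (\<lambda>xs ys. \<forall>x\<in>set xs. \<forall>y\<in>set ys. (\<lambda>(a, b) (c, d). {a, b} \<inter> {c, d} = {}) x y) (map P bs)"
      unfolding sorted_wrt_map
    proof (rule sorted_wrt_distinct[OF bs(2)], intro ballI)
      fix b b' x y assume b: "b \<in> set bs" "b' \<in> set bs" "b \<noteq> b'" and xy: "x \<in> set (P b)" "y \<in> set (P b')"
      obtain x1 x2 y1 y2 where "x = (x1, x2)" "y = (y1, y2)" by (cases x; cases y)
      then show "(\<lambda>(a, b) (c, d). {a, b} \<inter> {c, d} = {}) x y"
        using Pseg[of b x1 x2] Pseg[of b' y1 y2] xy b bs disj[of b b'] by auto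
    qed
  qed
  have set_cs: "set cs = (\<Union>b\<in>B. set (P b))" by (simp add: cs_def bs)
  have map: "movement_map N Z = fold swap_cubes (map (map_prod (cube N) (cube N)) cs)"
  proof -
    have "couples N (segment_array i b, swap_indices (fst (snd b)) (U b) (V b)) = map (map_prod (cube N) (cube N)) (P b)"
      if b: "b \<in> set bs" for b
    proof -
      obtain v lo hi where b': "b = (v, lo, hi)" by (cases b)
      have "U b \<subseteq> {lo..}" "V b \<subseteq> {lo..}" using UV[of v lo hi] b bs unfolding b' by fastforce+
      then show ?thesis using couples_segment[of "U b" "V b" lo N i v hi] finUV b bs by (simp add: P_def b')
    qed
    then show ?thesis
      unfolding movement_map_def Z_def cs_def map_concat map_map
      by (intro arg_cong[where f = "fold swap_cubes"] arg_cong[where f = concat] map_cong) auto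
  qed
  have "\<forall>(a, b)\<in>set cs. a \<in> cells N \<and> b \<in> cells N" unfolding set_cs using Pseg segc by blast
  then have acts: "acts N (movement_map N Z) z"
    unfolding map z_def by (rule acts_fold_swap_cubes[OF N])
  have elem: "elementary_movement N Z"
    unfolding elementary_movement_def
  proof (intro conjI)
    show "Z \<noteq> []" using B(2) bs(1) by (auto simp: Z_def)
    have "is_array N (segment_array i b) \<and> is_swap_seq N (segment_array i b) (swap_indices (fst (snd b)) (U b) (V b))"
      if b: "b \<in> B" for b
    proof -
      obtain v lo hi where b': "b = (v, lo, hi)" by (cases b)
      show ?thesis using seg[of v lo hi] UV[of v lo hi] b unfolding b'
        by (auto intro!: is_array_segment is_swap_seq_swap_indices N)
    qed
    then show "\<forall>(A, p)\<in>set Z. is_array N A \<and> is_swap_seq N A p" using bs by (auto simp: Z_def)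
    have "interior (array_set N (segment_array i b)) \<inter> interior (array_set N (segment_array i b')) = {}"
      if b: "b \<in> set bs" "b' \<in> set bs" "b \<noteq> b'" for b b'
    proof -
      have "segment i b \<inter> segment i b' = {}" using disj b bs by blast
      then show ?thesis
        using interior_segments_disjoint[OF N, of i "fst b" "fst (snd b)" "snd (snd b)"
          "fst b'" "fst (snd b')" "snd (snd b')"] by simp
    qed
    then show "sorted_wrt (\<lambda>(A, p) (B, q). interior (array_set N A) \<inter> interior (array_set N B) = {}) Z"
      unfolding Z_def sorted_wrt_map prod.case by (rule sorted_wrt_distinct[OF bs(2)])
  qed
  have "(\<Sum>(A, p)\<leftarrow>Z. num_couples p) = (\<Sum>b\<leftarrow>bs. card (U b))"
    unfolding Z_def map_map using finUV bs
    by (intro arg_cong[where f = sum_list] map_cong) (auto simp: num_couples_swap_indices)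
  also have "\<dots> = (\<Sum>b\<in>B. card (U b))" using bs by (simp add: sum_list_distinct_conv_sum_set)
  finally have num: "(\<Sum>(A, p)\<leftarrow>Z. num_couples p) = (\<Sum>b\<in>B. card (U b))" .
  have "array_length N (segment_array i b) \<le> l" if b: "b \<in> B" for b
  proof -
    obtain v lo hi where b': "b = (v, lo, hi)" by (cases b)
    show ?thesis using seg[of v lo hi] b N unfolding b' by (simp add: array_length_segment)
  qed
  then have "Max ((\<lambda>(A, p). array_length N A) ` set Z) \<le> l"
    using B bs by (intro Max.boundedI) (auto simp: Z_def)
  then have "movement_cost N Z \<le> real l * real N powr (- 1 - real CARD('n) / 2) * sqrt (real (\<Sum>b\<in>B. card (U b)))"
    unfolding movement_cost_def num by (intro mult_right_mono) (simp_all add: sum_nonneg)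
  then have "reaches N z (real l * real N powr (- 1 - real CARD('n) / 2) * sqrt (real (\<Sum>b\<in>B. card (U b))))"
    unfolding reaches_def by (intro exI[of _ "[Z]"]) (use elem acts in \<open>simp add: discrete_flow_def flow_length_def\<close>)
  moreover have "\<exists>y\<in>V b. z ((fst b)(i := x)) = (fst b)(i := y) \<and> z ((fst b)(i := y)) = (fst b)(i := x)"
    if b: "b \<in> B" and x: "x \<in> U b" for b x
  proof -
    obtain y where "y \<in> V b" "((fst b)(i := x), (fst b)(i := y)) \<in> set (P b)"
      using set_swap_pairs(2)[OF finUV(1-3)[OF b] x] unfolding P_def by blast
    then show ?thesis using fold_transpose_disjoint(1)[OF sorted] b unfolding z_def set_cs by blast
  qed
  moreover have "\<exists>x\<in>U b. z ((fst b)(i := x)) = (fst b)(i := y) \<and> z ((fst b)(i := y)) = (fst b)(i := x)"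
    if b: "b \<in> B" and y: "y \<in> V b" for b y
  proof -
    obtain x where "x \<in> U b" "((fst b)(i := x), (fst b)(i := y)) \<in> set (P b)"
      using set_swap_pairs(3)[OF finUV(1-3)[OF b] y] unfolding P_def by blast
    then show ?thesis using fold_transpose_disjoint(1)[OF sorted] b unfolding z_def set_cs by blast
  qed
  moreover have "z c = c" if c: "\<forall>b\<in>B. \<forall>x\<in>U b \<union> V b. c \<noteq> (fst b)(i := x)" for c
    unfolding z_def
  proof (rule fold_transpose_disjoint(2)[OF sorted], clarify)
    fix a b assume "(a, b) \<in> set cs"
    then obtain b' where b': "b' \<in> B" "(a, b) \<in> set (P b')" unfolding set_cs by blast
    then show "c \<noteq> a \<and> c \<noteq> b"
      using set_swap_pairs(1)[OF finUV(1-3)[OF b'(1)]] c unfolding P_def by blast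
  qed
  ultimately show ?thesis by (intro exI[of _ z]) blast
qed

section \<open>Permutations along lines\<close>

text \<open>Truncated subtraction is harmless here: blocks that the shift pushes partly or wholly
  below 0 become shorter or empty.\<close>

lemma div_segment:
  fixes x s W q :: nat
  assumes "W > 0"
  shows "(x + s) div W = q \<longleftrightarrow> q * W - s \<le> x \<and> x < (q + 1) * W - s"
proof -
  have "(x + s) div W = q \<longleftrightarrow> q * W \<le> x + s \<and> x + s < (q + 1) * W"
    using assms by (metis Suc_eq_plus1 div_nat_eqI dividend_less_times_div div_times_less_eq_dividend mult.commute mult_Suc_right add.commute)
  then show ?thesis by (simp only: le_diff_conv less_diff_conv)
qed

text \<open>Quicksort: one movement brings every cube into the correct half of its segment, in which the
  coordinate \<open>x + s\<close> has a fixed quotient by \<open>2^(k + 1)\<close>; the halves are then sorted in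
  parallel, and the array lengths decrease geometrically.\<close>

lemma reaches_line_permutation:
  fixes h :: "('n::finite \<Rightarrow> nat) \<Rightarrow> ('n \<Rightarrow> nat)" and i :: 'n
  assumes N: "N \<ge> 1"
    and "bij_betw h (cells N) (cells N)"
    and "\<And>c j. c \<in> cells N \<Longrightarrow> j \<noteq> i \<Longrightarrow> h c j = c j"
    and "\<And>c. c \<in> cells N \<Longrightarrow> (h c i + s) div 2 ^ k = (c i + s) div 2 ^ k"
    and "card {c \<in> cells N. h c \<noteq> c} \<le> m"
  shows "reaches N h (2 * (2 ^ k - 1) * real N powr (- 1 - real CARD('n) / 2) * sqrt (real m))"
  using assms(2-)
proof (induction k arbitrary: h)
  case 0
  have "h c = c" if "c \<in> cells N" for c
  proof
    fix j show "h c j = c j" using 0(2,3)[OF that] by (cases "j = i") auto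
  qed
  then show ?case using reaches_id[of N h] by simp
next
  case (Suc k)
  have parity: "a div 2 = b div 2 \<Longrightarrow> (odd a \<longleftrightarrow> odd b) \<Longrightarrow> a = b" for a b :: nat by presburger
  have parity_less: "a div 2 = b div 2 \<Longrightarrow> even a \<Longrightarrow> odd b \<Longrightarrow> a < b" for a b :: nat by presburger
  define W :: nat where "W = 2 ^ Suc k"
  define right where "right x \<longleftrightarrow> odd ((x + s) div 2 ^ k)" for x
  have W: "W > 0" by (simp add: W_def)
  have divW: "x div W = x div 2 ^ k div 2" for x unfolding W_def power_Suc2 div_mult2_eq ..
  have hW: "(h c i + s) div W = (c i + s) div W" if "c \<in> cells N" for c
    using Suc.prems(3)[OF that] by (simp add: W_def)
  have hcells: "h c \<in> cells N" if "c \<in> cells N" for c using Suc.prems(1) that by (auto simp: bij_betw_def)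
  \<comment> \<open>The condition \<open>v i = 0\<close> gives each segment a single name, so that
    disjointness holds for distinct triples; \<open>min N\<close> cuts a block that sticks out of
    the unit cube.\<close>
  define B where "B = {(v, lo, hi). v \<in> cells N \<and> v i = 0 \<and> lo < hi \<and> (\<exists>q. lo = q * W - s \<and> hi = min N ((q + 1) * W - s))}"
  have memseg: "x \<in> {q * W - s..<min N ((q + 1) * W - s)} \<longleftrightarrow> x < N \<and> (x + s) div W = q" for x q
    using div_segment[OF W, of x s q] by auto
  have inB: "\<exists>lo hi. (c(i := 0), lo, hi) \<in> B \<and> c i \<in> {lo..<hi}" if c: "c \<in> cells N" for c
  proof -
    have ci: "c i < N" using c by (simp add: cells_def)
    then have mem: "c i \<in> {(c i + s) div W * W - s..<min N (((c i + s) div W + 1) * W - s)}"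
      using memseg[of "c i" "(c i + s) div W"] by blast
    then have "(c i + s) div W * W - s < min N (((c i + s) div W + 1) * W - s)" by (metis atLeastLessThan_iff le_less_trans)
    then have "(c(i := 0), (c i + s) div W * W - s, min N (((c i + s) div W + 1) * W - s)) \<in> B"
      unfolding B_def using c N by (auto intro: cells_upd)
    then show ?thesis using mem by blast
  qed
  have finB: "finite B"
    by (rule finite_subset[of _ "cells N \<times> {..N} \<times> {..N}"]) (auto simp: B_def)
  have "(\<lambda>_. 0) \<in> cells N" using N by (simp add: cells_def)
  then have neB: "B \<noteq> {}" using inB by blast
  have Bprop: "v \<in> cells N \<and> v i = 0 \<and> lo < hi \<and> hi \<le> N \<and> hi - lo \<le> W \<and>
      (\<forall>x\<in>{lo..<hi}. v(i := x) \<in> cells N) \<and>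
      (\<exists>q. \<forall>x. x \<in> {lo..<hi} \<longleftrightarrow> x < N \<and> (x + s) div W = q)" if b: "(v, lo, hi) \<in> B" for v lo hi
  proof -
    obtain q where q: "lo = q * W - s" "hi = min N ((q + 1) * W - s)" and v: "v \<in> cells N" "v i = 0" "lo < hi"
      using b unfolding B_def by blast
    have "hi - lo \<le> (q + 1) * W - s - (q * W - s)" unfolding q by simp
    also have "\<dots> \<le> W" by simp
    finally have "hi - lo \<le> W" .
    moreover have "\<forall>x. x \<in> {lo..<hi} \<longleftrightarrow> x < N \<and> (x + s) div W = q" using memseg unfolding q by blast
    moreover have hi: "hi \<le> N" using q by simp
    moreover have "\<forall>x\<in>{lo..<hi}. v(i := x) \<in> cells N" using hi by (auto intro!: cells_upd v)
    ultimately show ?thesis using v by blast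
  qed
  have disj: "segment i b \<inter> segment i b' = {}" if b: "b \<in> B" "b' \<in> B" "b \<noteq> b'" for b b'
  proof (rule ccontr)
    assume "segment i b \<inter> segment i b' \<noteq> {}"
    then obtain c where c: "c \<in> segment i b" "c \<in> segment i b'" by blast
    obtain v q where v: "b = (v, q * W - s, min N ((q + 1) * W - s))" "v i = 0"
      using b(1) unfolding B_def by blast
    obtain v' q' where v': "b' = (v', q' * W - s, min N ((q' + 1) * W - s))" "v' i = 0"
      using b(2) unfolding B_def by blast
    obtain x where x1: "c = v(i := x)" "x \<in> {q * W - s..<min N ((q + 1) * W - s)}"
      using c(1) unfolding v segment_def prod.case by blast
    obtain x' where x2: "c = v'(i := x')" "x' \<in> {q' * W - s..<min N ((q' + 1) * W - s)}"
      using c(2) unfolding v' segment_def prod.case by blast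
    have x: "v(i := x) = v'(i := x')" "(x + s) div W = q" "(x' + s) div W = q'"
      using x1 x2 memseg by blast+
    then have "x = x'" by (metis fun_upd_same)
    moreover have "v = v'" using x(1) v(2) v'(2) by (metis fun_upd_triv fun_upd_upd)
    ultimately show False using x b(3) v v' by simp
  qed
  define U where "U = (\<lambda>(v, lo, hi). {x \<in> {lo..<hi}. \<not> right x \<and> right (h (v(i := x)) i)})"
  define V where "V = (\<lambda>(v, lo, hi). {x \<in> {lo..<hi}. right x \<and> \<not> right (h (v(i := x)) i)})"
  have UV: "U (v, lo, hi) \<subseteq> {lo..<hi} \<and> V (v, lo, hi) \<subseteq> {lo..<hi} \<and>
      card (U (v, lo, hi)) = card (V (v, lo, hi)) \<and> (\<forall>x\<in>U (v, lo, hi). \<forall>y\<in>V (v, lo, hi). x < y)"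
    if b: "(v, lo, hi) \<in> B" for v lo hi
  proof (intro conjI ballI)
    define S where "S = {lo..<hi}"
    obtain q where q: "\<And>x. x \<in> S \<longleftrightarrow> x < N \<and> (x + s) div W = q" using Bprop[OF b] unfolding S_def by blast
    define f where "f x = h (v(i := x)) i" for x
    have vc: "v(i := x) \<in> cells N" if "x \<in> S" for x using Bprop[OF b] that by (simp add: S_def)
    have fS: "f x \<in> S" if "x \<in> S" for x
      using hW[OF vc[OF that]] hcells[OF vc[OF that]] q[of x] that unfolding q f_def by (simp add: cells_def)
    have inj: "inj_on f S"
    proof (rule inj_onI)
      fix x y assume xy: "x \<in> S" "y \<in> S" "f x = f y"
      have "h (v(i := x)) = h (v(i := y))"
      proof
        fix j show "h (v(i := x)) j = h (v(i := y)) j"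
        proof (cases "j = i")
          case True
          then show ?thesis using xy(3) by (simp add: f_def)
        next
          case False
          have "h (v(i := u)) j = v j" if "u \<in> S" for u
            using Suc.prems(2)[OF vc[OF that] False] False by (metis fun_upd_other)
          then show ?thesis using xy by simp
        qed
      qed
      then have "v(i := x) = v(i := y)" using Suc.prems(1) vc xy by (meson bij_betw_def inj_onD)
      then show "x = y" by (metis fun_upd_same)
    qed
    have "f ` S = S" using inj fS by (intro endo_inj_surj) (auto simp: S_def)
    moreover have "f ` {x \<in> S. right (f x)} = {y \<in> f ` S. right y}" by auto
    ultimately have "bij_betw f {x \<in> S. right (f x)} {x \<in> S. right x}"
      unfolding bij_betw_def using inj_on_subset[OF inj] by simp
    then have card: "card {x \<in> S. right (f x)} = card {x \<in> S. right x}" by (rule bij_betw_same_card)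
    have "U (v, lo, hi) = {x \<in> S. right (f x)} - {x \<in> S. right x \<and> right (f x)}"
      "V (v, lo, hi) = {x \<in> S. right x} - {x \<in> S. right x \<and> right (f x)}"
      by (auto simp: U_def V_def S_def f_def)
    moreover have "finite S" by (simp add: S_def)
    ultimately show "card (U (v, lo, hi)) = card (V (v, lo, hi))"
      using card by (simp add: card_Diff_subset subset_iff)
    show "U (v, lo, hi) \<subseteq> {lo..<hi}" "V (v, lo, hi) \<subseteq> {lo..<hi}" by (auto simp: U_def V_def)
    fix x y assume xy: "x \<in> U (v, lo, hi)" "y \<in> V (v, lo, hi)"
    then have "x \<in> S" "y \<in> S" "\<not> right x" "right y" by (auto simp: U_def V_def S_def)
    then have e: "(x + s) div 2 ^ k div 2 = (y + s) div 2 ^ k div 2" "even ((x + s) div 2 ^ k)" "odd ((y + s) div 2 ^ k)"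
      using q divW by (auto simp: right_def)
    show "x < y"
    proof (rule ccontr)
      assume "\<not> x < y"
      then have "(y + s) div 2 ^ k \<le> (x + s) div 2 ^ k" by (intro div_le_mono) simp
      with parity_less[OF e] show False by simp
    qed
  qed
  have segB: "v \<in> cells N \<and> lo < hi \<and> hi \<le> N \<and> hi - lo \<le> W" if "(v, lo, hi) \<in> B" for v lo hi
    using Bprop[OF that] by blast
  obtain z where z: "reaches N z (real W * real N powr (- 1 - real CARD('n) / 2) * sqrt (real (\<Sum>b\<in>B. card (U b))))"
    and zU: "\<forall>b\<in>B. \<forall>x\<in>U b. \<exists>y\<in>V b. z ((fst b)(i := x)) = (fst b)(i := y) \<and> z ((fst b)(i := y)) = (fst b)(i := x)"
    and zV: "\<forall>b\<in>B. \<forall>y\<in>V b. \<exists>x\<in>U b. z ((fst b)(i := x)) = (fst b)(i := y) \<and> z ((fst b)(i := y)) = (fst b)(i := x)"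
    and zid: "\<forall>c. (\<forall>b\<in>B. \<forall>x\<in>U b \<union> V b. c \<noteq> (fst b)(i := x)) \<longrightarrow> z c = c"
    by (rule reaches_simultaneous_swaps[OF N finB neB segB disj UV, THEN exE];
        (assumption | elim conjE, rule that, assumption+))
  define Uc where "Uc c \<longleftrightarrow> \<not> right (c i) \<and> right (h c i)" for c
  define Vc where "Vc c \<longleftrightarrow> right (c i) \<and> \<not> right (h c i)" for c
  define ok where "ok c \<longleftrightarrow> z c \<in> cells N \<and> z (z c) = c \<and> (\<forall>j. j \<noteq> i \<longrightarrow> z c j = c j) \<and>
    (z c i + s) div W = (c i + s) div W" for c
  have step: "ok (v(i := x)) \<and> ok (v(i := y)) \<and> Uc (v(i := x)) \<and> Vc (v(i := y))"
    if b: "(v, lo, hi) \<in> B" and x: "x \<in> U (v, lo, hi)" and y: "y \<in> V (v, lo, hi)"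
    and zx: "z (v(i := x)) = v(i := y)" and zy: "z (v(i := y)) = v(i := x)" for v lo hi x y
  proof -
    have xy: "x \<in> {lo..<hi}" "y \<in> {lo..<hi}" using x y by (auto simp: U_def V_def)
    then have "(x + s) div W = (y + s) div W" using Bprop[OF b] by metis
    then show ?thesis using Bprop[OF b] xy x y by (auto simp: ok_def zx zy Uc_def Vc_def U_def V_def)
  qed
  have zUc: "ok c \<and> Vc (z c)" if c: "c \<in> cells N" "Uc c" for c
  proof -
    obtain lo hi where b: "(c(i := 0), lo, hi) \<in> B" "c i \<in> {lo..<hi}" using inB[OF c(1)] by blast
    then have x: "c i \<in> U (c(i := 0), lo, hi)" using c(2) by (simp add: U_def Uc_def)
    obtain y where y: "y \<in> V (c(i := 0), lo, hi)" "z c = c(i := y)" "z (c(i := y)) = c" using zU[rule_format, OF b(1) x] by auto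
    show ?thesis using step[OF b(1) x y(1)] y(2,3) by simp
  qed
  have zVc: "ok c \<and> Uc (z c)" if c: "c \<in> cells N" "Vc c" for c
  proof -
    obtain lo hi where b: "(c(i := 0), lo, hi) \<in> B" "c i \<in> {lo..<hi}" using inB[OF c(1)] by blast
    then have x: "c i \<in> V (c(i := 0), lo, hi)" using c(2) by (simp add: V_def Vc_def)
    obtain y where y: "y \<in> U (c(i := 0), lo, hi)" "z c = c(i := y)" "z (c(i := y)) = c" using zV[rule_format, OF b(1) x] by auto
    show ?thesis using step[OF b(1) y(1) x] y(2,3) by simp
  qed
  have zidc: "z c = c" if c: "c \<in> cells N" "\<not> Uc c" "\<not> Vc c" for c
  proof (rule mp[OF spec[OF zid]], intro ballI)
    fix b x assume b: "b \<in> B" "x \<in> U b \<union> V b"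
    obtain v lo hi where b': "b = (v, lo, hi)" by (cases b)
    show "c \<noteq> (fst b)(i := x)" using b c(2,3) by (auto simp: b' U_def V_def Uc_def Vc_def)
  qed
  have ok: "ok c" if c: "c \<in> cells N" for c
    using zUc[OF c] zVc[OF c] zidc[OF c] c by (cases "Uc c"; cases "Vc c") (auto simp: ok_def)
  \<comment> \<open>As \<open>z\<close> is an involution on the cells,
    \<open>h c = h' (z c)\<close>: the movement comes first, and \<open>h'\<close> is what remains
    to be sorted inside the halves.\<close>
  define h' where "h' c = h (z c)" for c
  have "bij_betw z (cells N) (cells N)"
    by (rule bij_betw_byWitness[where f' = z]) (use ok in \<open>auto simp: ok_def\<close>)
  then have "bij_betw h' (cells N) (cells N)"
    unfolding h'_def using Suc.prems(1) bij_betw_trans[of z _ _ h] by (simp add: comp_def)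
  moreover have "h' c j = c j" if "c \<in> cells N" "j \<noteq> i" for c j
    using ok[OF that(1)] that Suc.prems(2)[of "z c" j] by (simp add: ok_def h'_def)
  moreover have "(h' c i + s) div 2 ^ k = (c i + s) div 2 ^ k" if c: "c \<in> cells N" for c
  proof -
    have "(h' c i + s) div W = (c i + s) div W" using ok[OF c] hW[of "z c"] by (simp add: ok_def h'_def)
    then have "(h' c i + s) div 2 ^ k div 2 = (c i + s) div 2 ^ k div 2" by (simp add: divW)
    \<comment> \<open>A swapped cell \<open>c\<close> takes over the target of its partner
      \<open>z c\<close>, and that target lies in the half of \<open>c\<close>.\<close>
    moreover have "right (h' c i) \<longleftrightarrow> right (c i)"
      using zUc[OF c] zVc[OF c] zidc[OF c] by (cases "Uc c"; cases "Vc c") (auto simp: h'_def Uc_def Vc_def)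
    ultimately show ?thesis unfolding right_def by (rule parity)
  qed
  moreover have "card {c \<in> cells N. h' c \<noteq> c} \<le> m"
  proof -
    \<comment> \<open>Misplaced cells are moved by \<open>h\<close>, so the movement leaves the
      fixed cells of \<open>h\<close> alone, and the same \<open>m\<close> serves at every
      level.\<close>
    have "{c \<in> cells N. h' c \<noteq> c} \<subseteq> {c \<in> cells N. h c \<noteq> c}"
      using zidc by (auto simp: h'_def Uc_def Vc_def)
    then have "card {c \<in> cells N. h' c \<noteq> c} \<le> card {c \<in> cells N. h c \<noteq> c}"
      by (intro card_mono) auto
    then show ?thesis using Suc.prems(4) by simp
  qed
  ultimately have h': "reaches N h' (2 * (2 ^ k - 1) * real N powr (- 1 - real CARD('n) / 2) * sqrt (real m))"
    by (rule Suc.IH)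
  \<comment> \<open>Couples are counted by their left cells, which are distinct because the segments
    are disjoint, and which \<open>h\<close> moves.\<close>
  have "(\<Sum>b\<in>B. card (U b)) = card (Sigma B U)"
    using finB by (subst card_SigmaI) (auto simp: U_def)
  also have "\<dots> \<le> card {c \<in> cells N. h c \<noteq> c}"
  proof (rule card_inj_on_le)
    show "inj_on (\<lambda>(b, x). (fst b)(i := x)) (Sigma B U)"
    proof (rule inj_onI)
      fix p p' assume p: "p \<in> Sigma B U" "p' \<in> Sigma B U" "(\<lambda>(b, x). (fst b)(i := x)) p = (\<lambda>(b, x). (fst b)(i := x)) p'"
      obtain v lo hi x where p1: "p = ((v, lo, hi), x)" by (metis surj_pair)
      obtain v' lo' hi' x' where p2: "p' = ((v', lo', hi'), x')" by (metis surj_pair)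
      have b: "(v, lo, hi) \<in> B" "x \<in> U (v, lo, hi)" "(v', lo', hi') \<in> B" "x' \<in> U (v', lo', hi')"
        and eq: "v(i := x) = v'(i := x')"
        using p by (simp_all add: p1 p2)
      have "v(i := x) \<in> segment i (v, lo, hi)" "v'(i := x') \<in> segment i (v', lo', hi')"
        using b UV unfolding segment_def by blast+
      then have "(v, lo, hi) = (v', lo', hi')" using disj[OF b(1,3)] eq by auto
      moreover have "x = x'" using eq by (metis fun_upd_same)
      ultimately show "p = p'" by (simp add: p1 p2)
    qed
    show "(\<lambda>(b, x). (fst b)(i := x)) ` Sigma B U \<subseteq> {c \<in> cells N. h c \<noteq> c}"
    proof
      fix c assume "c \<in> (\<lambda>(b, x). (fst b)(i := x)) ` Sigma B U"
      then obtain v lo hi x where b: "(v, lo, hi) \<in> B" "x \<in> U (v, lo, hi)" and c: "c = v(i := x)" by auto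
      then have "h (v(i := x)) i \<noteq> x" "x \<in> {lo..<hi}" by (auto simp: U_def)
      then have "h c \<noteq> c" unfolding c by (metis fun_upd_same)
      then show "c \<in> {c \<in> cells N. h c \<noteq> c}" using Bprop[OF b(1)] \<open>x \<in> {lo..<hi}\<close> c by blast
    qed
  qed auto
  also have "\<dots> \<le> m" by (rule Suc.prems(4))
  finally have "sqrt (real (\<Sum>b\<in>B. card (U b))) \<le> sqrt (real m)" by (simp del: of_nat_sum)
  then have "real W * real N powr (- 1 - real CARD('n) / 2) * sqrt (real (\<Sum>b\<in>B. card (U b))) +
      2 * (2 ^ k - 1) * real N powr (- 1 - real CARD('n) / 2) * sqrt (real m)
    \<le> real W * real N powr (- 1 - real CARD('n) / 2) * sqrt (real m) +
      2 * (2 ^ k - 1) * real N powr (- 1 - real CARD('n) / 2) * sqrt (real m)"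
    by (intro add_right_mono mult_left_mono) auto
  \<comment> \<open>The levels add up to the geometric series
    \<open>2 ^ (k + 1) + ... + 2\<close>.\<close>
  also have "\<dots> = 2 * (2 ^ Suc k - 1) * real N powr (- 1 - real CARD('n) / 2) * sqrt (real m)"
    by (simp add: W_def algebra_simps)
  finally show ?case
    using reaches_cong[OF reaches_comp[OF N z h'], of h] ok by (simp add: h'_def ok_def)
qed

section \<open>Routing permutations through lines\<close>

text \<open>As in three-phase routing: a regular edge colouring of the multigraph with an edge from the
  line of \<open>c\<close> to the line of \<open>\<tau> c\<close> gives every cube an intermediate coordinate \<open>\<gamma> c\<close>, at which
  it changes lines without conflicts.\<close>

lemma reaches_block_permutation:
  fixes \<tau> :: "('n::finite \<Rightarrow> nat) \<Rightarrow> ('n \<Rightarrow> nat)" and J :: "'n set"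
  assumes N: "N \<ge> 1" and "finite J"
    and "bij_betw \<tau> (cells N) (cells N)"
    and "\<And>c j. c \<in> cells N \<Longrightarrow> j \<notin> J \<Longrightarrow> \<tau> c j = c j"
    and "\<And>c j. c \<in> cells N \<Longrightarrow> (\<tau> c j + s) div 2 ^ k = (c j + s) div 2 ^ k"
    and "card {c \<in> cells N. \<tau> c \<noteq> c} \<le> m"
  shows "reaches N \<tau> (real (4 * card J) * (2 * (2 ^ k - 1) * real N powr (- 1 - real CARD('n) / 2) * sqrt (real m)))"
  using assms(2-)
proof (induction J arbitrary: \<tau> rule: finite_induct)
  case empty
  then show ?case using reaches_id[of N \<tau>] by (auto simp: fun_eq_iff)
next
  case (insert i J)
  define E where "E = 2 * (2 ^ k - 1) * real N powr (- 1 - real CARD('n) / 2)"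
  define blk where "blk x = (x + s) div 2 ^ k" for x
  \<comment> \<open>A vertex is the piece of a line in direction \<open>i\<close> inside one block,
    so that intermediate coordinates never leave the block. The cell \<open>c\<close> is the edge
    from its own piece to that of \<open>\<tau> c\<close>.\<close>
  define a where "a c = (c(i := 0), blk (c i))" for c
  define b where "b c = ((\<tau> c)(i := 0), blk (c i))" for c
  have \<tau>blk: "blk (\<tau> c j) = blk (c j)" if "c \<in> cells N" for c j
    using insert.prems(3)[OF that] by (simp add: blk_def)
  have \<tau>cells: "\<tau> c \<in> cells N" if "c \<in> cells N" for c
    using insert.prems(1) that by (auto simp: bij_betw_def)
  have b_eq: "b c = a (\<tau> c)" if "c \<in> cells N" for c
    using \<tau>blk[OF that] by (simp add: a_def b_def)
  \<comment> \<open>Blocks cut off by the boundary are shorter, so the multigraph is regular only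
    over a fixed quotient \<open>q\<close>. Each layer is coloured separately, with its own
    coordinates as colours.\<close>
  define P where "P q \<gamma> \<longleftrightarrow> \<gamma> ` {c \<in> cells N. blk (c i) = q} \<subseteq> {x. x < N \<and> blk x = q} \<and>
      inj_on (\<lambda>c. (a c, \<gamma> c)) {c \<in> cells N. blk (c i) = q} \<and>
      inj_on (\<lambda>c. (b c, \<gamma> c)) {c \<in> cells N. blk (c i) = q}" for q \<gamma>
  have "\<exists>\<gamma>. P q \<gamma>" for q
  proof -
    define X where "X = {c \<in> cells N. blk (c i) = q}"
    define I where "I = {x. x < N \<and> blk x = q}"
    have XC: "c \<in> cells N" if "c \<in> X" for c using that by (simp add: X_def)
    have \<tau>X: "bij_betw \<tau> X X"
    proof -
      have "inj_on \<tau> X" using insert.prems(1) by (auto simp: X_def bij_betw_def intro: inj_on_subset)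
      moreover have "\<tau> ` X \<subseteq> X" using \<tau>cells \<tau>blk by (auto simp: X_def)
      ultimately show ?thesis by (simp add: bij_betw_def endo_inj_surj X_def)
    qed
    have fibre: "card {c \<in> X. a c = v} = card I" if v: "v \<in> a ` X" for v
    proof -
      obtain d where d: "d \<in> X" "v = a d" using v by blast
      have "{c \<in> X. a c = v} = (\<lambda>x. d(i := x)) ` I"
      proof (intro set_eqI iffI)
        fix c assume c: "c \<in> {c \<in> X. a c = v}"
        then have "c(i := 0) = d(i := 0)" by (simp add: a_def d)
        then have "c = d(i := c i)" by (metis fun_upd_triv fun_upd_upd)
        moreover have "c i \<in> I" using c by (auto simp: X_def I_def cells_def)
        ultimately show "c \<in> (\<lambda>x. d(i := x)) ` I" by blast
      next
        fix c assume "c \<in> (\<lambda>x. d(i := x)) ` I"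
        then show "c \<in> {c \<in> X. a c = v}" using d by (auto simp: X_def I_def a_def intro: cells_upd)
      qed
      moreover have "inj_on (\<lambda>x. d(i := x)) I" by (rule inj_onI) (metis fun_upd_same)
      ultimately show ?thesis by (simp add: card_image)
    qed
    have bX: "b ` X \<subseteq> a ` X" using b_eq XC \<tau>X by (auto simp: bij_betw_def)
    have fibre_b: "card {c \<in> X. b c = v} = card I" if v: "v \<in> a ` X" for v
    proof -
      have "\<tau> ` {c \<in> X. b c = v} = {c \<in> \<tau> ` X. a c = v}" using b_eq XC by auto
      also have "\<tau> ` X = X" using \<tau>X by (simp add: bij_betw_def)
      finally have "\<tau> ` {c \<in> X. b c = v} = {c \<in> X. a c = v}" .
      moreover have "inj_on \<tau> {c \<in> X. b c = v}" using \<tau>X by (auto simp: bij_betw_def intro: inj_on_subset)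
      ultimately show ?thesis using fibre[OF v] card_image[of \<tau> "{c \<in> X. b c = v}"] by simp
    qed
    have "finite I" "finite X" by (simp_all add: I_def X_def)
    then have "\<exists>\<gamma>. \<gamma> ` X \<subseteq> I \<and> inj_on (\<lambda>c. (a c, \<gamma> c)) X \<and> inj_on (\<lambda>c. (b c, \<gamma> c)) X"
      using regular_edge_coloring[of I X "a ` X" a b] fibre fibre_b bX by blast
    then show ?thesis by (simp add: X_def I_def P_def)
  qed
  then obtain \<gamma>q where "\<And>q. P q (\<gamma>q q)" by metis
  then have \<gamma>q: "\<And>q. \<gamma>q q ` {c \<in> cells N. blk (c i) = q} \<subseteq> {x. x < N \<and> blk x = q}"
    "\<And>q. inj_on (\<lambda>c. (a c, \<gamma>q q c)) {c \<in> cells N. blk (c i) = q}"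
    "\<And>q. inj_on (\<lambda>c. (b c, \<gamma>q q c)) {c \<in> cells N. blk (c i) = q}"
    unfolding P_def by blast+
  define \<gamma>0 where "\<gamma>0 c = \<gamma>q (blk (c i)) c" for c
  have \<gamma>0: "\<gamma>0 c < N" "blk (\<gamma>0 c) = blk (c i)" if "c \<in> cells N" for c
    using \<gamma>q(1)[of "blk (c i)"] that by (auto simp: \<gamma>0_def)
  have inj0: "inj_on (\<lambda>c. (f c, \<gamma>0 c)) (cells N)"
    if "\<And>q. inj_on (\<lambda>c. (f c, \<gamma>q q c)) {c \<in> cells N. blk (c i) = q}" for f :: "('n \<Rightarrow> nat) \<Rightarrow> ('n \<Rightarrow> nat) \<times> nat"
  proof (rule inj_onI)
    fix c d assume cd: "c \<in> cells N" "d \<in> cells N" "(f c, \<gamma>0 c) = (f d, \<gamma>0 d)"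
    then have "blk (c i) = blk (d i)" using \<gamma>0(2) by (metis prod.inject)
    then show "c = d" using that[of "blk (c i)"] cd unfolding inj_on_def \<gamma>0_def by auto
  qed
  have a_inj: "c = d" if "a c = a d" "c i = d i" for c d
    using that unfolding a_def by (metis fun_upd_triv fun_upd_upd prod.inject)
  \<comment> \<open>The preferred colour of a cell is its present coordinate; a cell that receives
    it stays put in the first phase.\<close>
  have pref: "inj_on (\<lambda>c. (a c, c i)) (cells N)"
    by (rule inj_onI) (use a_inj in auto)
  have "(\<lambda>c. (a c, \<gamma>0 c)) ` cells N \<subseteq> (\<lambda>c. (a c, c i)) ` cells N"
  proof
    fix y assume "y \<in> (\<lambda>c. (a c, \<gamma>0 c)) ` cells N"
    then obtain c where c: "c \<in> cells N" "y = (a c, \<gamma>0 c)" by blast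
    then have "c(i := \<gamma>0 c) \<in> cells N" "y = (a (c(i := \<gamma>0 c)), (c(i := \<gamma>0 c)) i)"
      using \<gamma>0 by (auto simp: a_def intro: cells_upd)
    then show "y \<in> (\<lambda>c. (a c, c i)) ` cells N" by blast
  qed
  then have img0: "(\<lambda>c. (a c, \<gamma>0 c)) ` cells N = (\<lambda>c. (a c, c i)) ` cells N"
    by (intro card_subset_eq) (use inj0[OF \<gamma>q(2)] pref in \<open>auto simp: card_image\<close>)
  obtain \<gamma> where \<gamma>a: "inj_on (\<lambda>c. (a c, \<gamma> c)) (cells N)" and \<gamma>b: "inj_on (\<lambda>c. (b c, \<gamma> c)) (cells N)"
    and img: "(\<lambda>c. (a c, \<gamma> c)) ` cells N = (\<lambda>c. (a c, c i)) ` cells N"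
    and \<gamma>card: "card {c \<in> cells N. \<gamma> c \<noteq> c i} \<le> 2 * card {c \<in> cells N. a c \<noteq> b c}"
    using edge_coloring_preferred[OF finite_cells pref inj0[OF \<gamma>q(2)] inj0[OF \<gamma>q(3)] img0] by blast
  have \<gamma>: "\<gamma> c < N \<and> blk (\<gamma> c) = blk (c i)" if c: "c \<in> cells N" for c
  proof -
    have "(a c, \<gamma> c) \<in> (\<lambda>c. (a c, c i)) ` cells N" unfolding img[symmetric] using c by blast
    then obtain d where "d \<in> cells N" "a c = a d" "\<gamma> c = d i" by auto
    then show ?thesis by (auto simp: a_def cells_def)
  qed
  define m0 where "m0 = card {c \<in> cells N. \<tau> c \<noteq> c}"
  have m0: "m0 \<le> m" using insert.prems(4) by (simp add: m0_def)
  \<comment> \<open>Fixed cells of \<open>\<tau>\<close> are loops, so there are at most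
    \<open>m0\<close> non-loops, and the preferred colouring changes at most \<open>2 * m0\<close>
    coordinates.\<close>
  have "card {c \<in> cells N. a c \<noteq> b c} \<le> m0"
    unfolding m0_def by (rule card_mono) (auto simp: a_def b_def)
  then have \<gamma>m: "card {c \<in> cells N. \<gamma> c \<noteq> c i} \<le> 2 * m0" using \<gamma>card by simp
  \<comment> \<open>\<open>h1 c\<close> and \<open>g c\<close> are the positions of the cell
    \<open>c\<close> before and after the middle phase. Properness of the colouring at the two ends
    of the edges makes both maps injective.\<close>
  define h1 where "h1 c = c(i := \<gamma> c)" for c
  define g where "g c = (\<tau> c)(i := \<gamma> c)" for c
  have inj: "inj_on h1 (cells N)" "inj_on g (cells N)"
  proof -
    show "inj_on h1 (cells N)"
    proof (rule inj_onI)
      fix c d assume cd: "c \<in> cells N" "d \<in> cells N" "h1 c = h1 d"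
      then have "\<gamma> c = \<gamma> d" "c(i := 0) = d(i := 0)" unfolding h1_def by (metis fun_upd_same, metis fun_upd_upd)
      moreover have "blk (c i) = blk (d i)" using \<gamma> cd calculation(1) by metis
      ultimately have "(a c, \<gamma> c) = (a d, \<gamma> d)" by (simp add: a_def)
      then show "c = d" using inj_onD[OF \<gamma>a _ cd(1,2)] by blast
    qed
    show "inj_on g (cells N)"
    proof (rule inj_onI)
      fix c d assume cd: "c \<in> cells N" "d \<in> cells N" "g c = g d"
      then have "\<gamma> c = \<gamma> d" "(\<tau> c)(i := 0) = (\<tau> d)(i := 0)" unfolding g_def by (metis fun_upd_same, metis fun_upd_upd)
      moreover have "blk (c i) = blk (d i)" using \<gamma> cd calculation(1) by metis
      ultimately have "(b c, \<gamma> c) = (b d, \<gamma> d)" by (simp add: b_def)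
      then show "c = d" using inj_onD[OF \<gamma>b _ cd(1,2)] by blast
    qed
  qed
  have h1cells: "h1 c \<in> cells N" and gcells: "g c \<in> cells N" if "c \<in> cells N" for c
    using \<gamma>[OF that] \<tau>cells[OF that] that by (auto simp: h1_def g_def intro: cells_upd)
  have bij1: "bij_betw h1 (cells N) (cells N)" and bijg: "bij_betw g (cells N) (cells N)"
  proof -
    have "h1 ` cells N = cells N" by (rule endo_inj_surj[OF finite_cells _ inj(1)]) (use h1cells in auto)
    moreover have "g ` cells N = cells N" by (rule endo_inj_surj[OF finite_cells _ inj(2)]) (use gcells in auto)
    ultimately show "bij_betw h1 (cells N) (cells N)" "bij_betw g (cells N) (cells N)"
      using inj by (simp_all add: bij_betw_def)
  qed
  \<comment> \<open>The middle phase \<open>h2\<close> keeps the coordinate \<open>i\<close> and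
    falls under the induction hypothesis; \<open>h3\<close> moves along lines in direction
    \<open>i\<close> to the targets.\<close>
  define h2 where "h2 = g \<circ> inv_into (cells N) h1"
  define h3 where "h3 = \<tau> \<circ> inv_into (cells N) g"
  have h2: "h2 (h1 c) = g c" and h3: "h3 (g c) = \<tau> c" if "c \<in> cells N" for c
    using that inj by (simp_all add: h2_def h3_def)
  have bij2: "bij_betw h2 (cells N) (cells N)" and bij3: "bij_betw h3 (cells N) (cells N)"
    unfolding h2_def h3_def
    using bij_betw_trans[OF bij_betw_inv_into[OF bij1] bijg] bij_betw_trans[OF bij_betw_inv_into[OF bijg] insert.prems(1)] .
  have ex1: "\<exists>c\<in>cells N. c' = h1 c" and exg: "\<exists>c\<in>cells N. c' = g c" if "c' \<in> cells N" for c'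
    using bij1 bijg that by (auto simp: bij_betw_def)
  \<comment> \<open>The outer phases move at most \<open>2 * m\<close> and \<open>3 * m\<close>
    cells. Rounding up to \<open>4 * m\<close> makes the root exact.\<close>
  have E: "E * sqrt (real (4 * m)) = 2 * (E * sqrt (real m))" by (simp add: real_sqrt_mult)
  have r1: "reaches N h1 (2 * (E * sqrt (real m)))"
    unfolding E[symmetric] unfolding E_def
  proof (rule reaches_line_permutation[OF N bij1, where i = i and s = s])
    show "h1 c j = c j" if "c \<in> cells N" "j \<noteq> i" for c j using that by (simp add: h1_def)
    show "(h1 c i + s) div 2 ^ k = (c i + s) div 2 ^ k" if "c \<in> cells N" for c
      using \<gamma>[OF that] by (simp add: h1_def blk_def)
    have "{c \<in> cells N. h1 c \<noteq> c} \<subseteq> {c \<in> cells N. \<gamma> c \<noteq> c i}" by (auto simp: h1_def)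
    then have "card {c \<in> cells N. h1 c \<noteq> c} \<le> card {c \<in> cells N. \<gamma> c \<noteq> c i}" by (intro card_mono) auto
    then show "card {c \<in> cells N. h1 c \<noteq> c} \<le> 4 * m" using \<gamma>m m0 by simp
  qed
  have r3: "reaches N h3 (2 * (E * sqrt (real m)))"
    unfolding E[symmetric] unfolding E_def
  proof (rule reaches_line_permutation[OF N bij3, where i = i and s = s])
    show "h3 c j = c j" if "c \<in> cells N" "j \<noteq> i" for c j
      using exg[OF that(1)] that(2) h3 by (auto simp: g_def)
    show "(h3 c i + s) div 2 ^ k = (c i + s) div 2 ^ k" if "c \<in> cells N" for c
    proof -
      obtain d where d: "d \<in> cells N" "c = g d" using exg[OF \<open>c \<in> cells N\<close>] by blast
      then have "blk (h3 c i) = blk (c i)" using h3[OF d(1)] \<gamma>[OF d(1)] \<tau>blk[OF d(1)] by (simp add: g_def)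
      then show ?thesis by (simp add: blk_def)
    qed
    have "{c \<in> cells N. h3 c \<noteq> c} \<subseteq> g ` ({c \<in> cells N. \<tau> c \<noteq> c} \<union> {c \<in> cells N. \<gamma> c \<noteq> c i})"
    proof
      fix c assume c: "c \<in> {c \<in> cells N. h3 c \<noteq> c}"
      then obtain d where d: "d \<in> cells N" "c = g d" using exg by blast
      then have "\<tau> d \<noteq> g d" using c h3 by auto
      then have "\<tau> d \<noteq> d \<or> \<gamma> d \<noteq> d i" by (auto simp: g_def)
      then show "c \<in> g ` ({c \<in> cells N. \<tau> c \<noteq> c} \<union> {c \<in> cells N. \<gamma> c \<noteq> c i})" using d by blast
    qed
    then have "card {c \<in> cells N. h3 c \<noteq> c} \<le> card ({c \<in> cells N. \<tau> c \<noteq> c} \<union> {c \<in> cells N. \<gamma> c \<noteq> c i})"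
      by (intro surj_card_le) auto
    also have "\<dots> \<le> m0 + card {c \<in> cells N. \<gamma> c \<noteq> c i}" unfolding m0_def by (rule card_Un_le)
    finally show "card {c \<in> cells N. h3 c \<noteq> c} \<le> 4 * m" using \<gamma>m m0 by simp
  qed
  have r2: "reaches N h2 (real (4 * card J) * (E * sqrt (real m)))"
    unfolding E_def
  proof (rule insert.IH[OF bij2])
    show "h2 c j = c j" if "c \<in> cells N" "j \<notin> J" for c j
    proof -
      obtain d where d: "d \<in> cells N" "c = h1 d" using ex1[OF \<open>c \<in> cells N\<close>] by blast
      then show ?thesis using h2[OF d(1)] insert.prems(2)[OF d(1), of j] \<open>j \<notin> J\<close> by (auto simp: g_def h1_def)
    qed
    show "(h2 c j + s) div 2 ^ k = (c j + s) div 2 ^ k" if "c \<in> cells N" for c j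
    proof -
      obtain d where d: "d \<in> cells N" "c = h1 d" using ex1[OF \<open>c \<in> cells N\<close>] by blast
      then show ?thesis using h2[OF d(1)] insert.prems(3)[OF d(1), of j] by (auto simp: g_def h1_def)
    qed
    \<comment> \<open>The middle phase fixes \<open>h1 d\<close> whenever
      \<open>\<tau> d = d\<close>. So the number of moved cells does not grow through the recursion,
      and the cost stays linear in \<open>card J\<close>.\<close>
    have "{c \<in> cells N. h2 c \<noteq> c} \<subseteq> h1 ` {c \<in> cells N. \<tau> c \<noteq> c}"
    proof
      fix c assume c: "c \<in> {c \<in> cells N. h2 c \<noteq> c}"
      then obtain d where d: "d \<in> cells N" "c = h1 d" using ex1 by blast
      then have "g d \<noteq> h1 d" using c h2 by auto
      then have "\<tau> d \<noteq> d" by (auto simp: g_def h1_def)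
      then show "c \<in> h1 ` {c \<in> cells N. \<tau> c \<noteq> c}" using d by blast
    qed
    then have "card {c \<in> cells N. h2 c \<noteq> c} \<le> m0"
      unfolding m0_def by (intro surj_card_le) auto
    then show "card {c \<in> cells N. h2 c \<noteq> c} \<le> m" using m0 by simp
  qed
  have cost: "2 * (E * sqrt (real m)) + real (4 * card J) * (E * sqrt (real m)) + 2 * (E * sqrt (real m)) =
    real (4 * card (insert i J)) * (E * sqrt (real m))"
    using insert.hyps by (simp add: algebra_simps)
  show ?case
    using reaches_cong[OF reaches_comp[OF N reaches_comp[OF N r1 r2] r3], of \<tau>] h2 h3
    by (simp only: cost E_def[symmetric])
qed

section \<open>Shifted blocks and coarse permutations\<close>

lemma hermite_sum:
  fixes w x :: nat
  assumes "w > 0"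
  shows "(\<Sum>s<w. (x + s) div w) = x"
proof (induction x)
  case 0
  show ?case by simp
next
  case (Suc x)
  \<comment> \<open>Raising \<open>x\<close> by one shifts the window of summation: the term
    \<open>x div w\<close> is lost and \<open>(x + w) div w = x div w + 1\<close> is gained.\<close>
  have "(\<Sum>s<w. (Suc x + s) div w) + x div w = (\<Sum>s<Suc w. (x + s) div w)"
    by (subst sum.lessThan_Suc_shift) simp
  also have "\<dots> = x + (x + w) div w" using Suc by simp
  finally show ?case using assms by simp
qed

text \<open>For \<open>x \<le> y\<close>, each separating shift adds at least 1 to the sum of the
  differences \<open>(y + s) div w - (x + s) div w\<close>, and this sum is \<open>y - x\<close> by
  Hermite's identity. The right-hand side is the absolute difference, written with truncated
  subtraction.\<close>

lemma card_separating_shifts: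
  fixes w x y :: nat
  assumes "w > 0"
  shows "card {s \<in> {..<w}. (x + s) div w \<noteq> (y + s) div w} \<le> (x - y) + (y - x)"
proof -
  have *: "card {s \<in> {..<w}. (x + s) div w \<noteq> (y + s) div w} \<le> y - x" if "x \<le> y" for x y
  proof -
    have le: "(x + s) div w \<le> (y + s) div w" for s using that by (intro div_le_mono) simp
    have "card {s \<in> {..<w}. (x + s) div w \<noteq> (y + s) div w} =
      (\<Sum>s<w. if (x + s) div w \<noteq> (y + s) div w then 1 else 0)"
      by (simp add: sum.If_cases Int_def)
    also have "\<dots> \<le> (\<Sum>s<w. (y + s) div w - (x + s) div w)"
      using le by (intro sum_mono) (auto simp: Suc_le_eq le_neq_implies_less)
    also have "\<dots> = (\<Sum>s<w. (y + s) div w) - (\<Sum>s<w. (x + s) div w)"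
      using le by (intro sum_subtractf_nat) auto
    finally show ?thesis by (simp add: hermite_sum[OF assms])
  qed
  have sym: "{s \<in> {..<w}. (x + s) div w \<noteq> (y + s) div w} = {s \<in> {..<w}. (y + s) div w \<noteq> (x + s) div w}"
    by auto
  show ?thesis using *[of x y] *[of y x] unfolding sym[symmetric] by (cases "x \<le> y") auto
qed

text \<open>Averaging: summed over all \<open>w\<close> shifts, the separated pairs of a cell and a
  coordinate number at most the total displacement, so some shift does no worse than the
  mean.\<close>

lemma exists_good_shift:
  fixes f :: "('n::finite \<Rightarrow> nat) \<Rightarrow> ('n \<Rightarrow> nat)"
  assumes "finite X" "w > 0"
  shows "\<exists>s. w * card {c \<in> X. \<exists>i. (f c i + s) div w \<noteq> (c i + s) div w} \<le>
    (\<Sum>c\<in>X. \<Sum>i\<in>UNIV. (f c i - c i) + (c i - f c i))"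
proof (rule ccontr)
  define D where "D = (\<Sum>c\<in>X. \<Sum>i\<in>UNIV. (f c i - c i) + (c i - f c i))"
  define M where "M s = {c \<in> X. \<exists>i. (f c i + s) div w \<noteq> (c i + s) div w}" for s
  assume "\<not> ?thesis"
  then have gt: "D < w * card (M s)" for s by (simp add: D_def M_def not_le)
  have "card (M s) \<le> (\<Sum>c\<in>X. \<Sum>i\<in>UNIV. if (f c i + s) div w \<noteq> (c i + s) div w then 1 else 0)" for s
  proof -
    have "card (M s) = (\<Sum>c\<in>X. if c \<in> M s then 1 else 0)"
      using assms(1) by (simp add: sum.If_cases M_def Int_def)
    also have "\<dots> \<le> (\<Sum>c\<in>X. \<Sum>i\<in>UNIV. if (f c i + s) div w \<noteq> (c i + s) div w then 1 else 0)"
    proof (rule sum_mono)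
      fix c assume "c \<in> X"
      show "(if c \<in> M s then 1 else 0) \<le> (\<Sum>i\<in>UNIV. if (f c i + s) div w \<noteq> (c i + s) div w then 1 else (0::nat))"
      proof (cases "c \<in> M s")
        case True
        then obtain i where "(f c i + s) div w \<noteq> (c i + s) div w" by (auto simp: M_def)
        then show ?thesis
          using member_le_sum[of i UNIV "\<lambda>i. if (f c i + s) div w \<noteq> (c i + s) div w then 1 else (0::nat)"] by simp
      qed simp
    qed
    finally show ?thesis .
  qed
  then have "(\<Sum>s<w. card (M s)) \<le>
    (\<Sum>s<w. \<Sum>c\<in>X. \<Sum>i\<in>UNIV. if (f c i + s) div w \<noteq> (c i + s) div w then 1 else 0)"
    by (intro sum_mono) blast
  also have "\<dots> = (\<Sum>c\<in>X. \<Sum>i\<in>UNIV. \<Sum>s<w. if (f c i + s) div w \<noteq> (c i + s) div w then 1 else 0)"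
    by (subst sum.swap) (intro sum.cong refl sum.swap)
  also have "\<dots> \<le> D"
    unfolding D_def
  proof (intro sum_mono)
    fix c i
    have "(\<Sum>s<w. if (f c i + s) div w \<noteq> (c i + s) div w then 1 else 0) =
      card {s \<in> {..<w}. (f c i + s) div w \<noteq> (c i + s) div w}" by (simp add: sum.If_cases Int_def)
    then show "(\<Sum>s<w. if (f c i + s) div w \<noteq> (c i + s) div w then 1 else 0) \<le> f c i - c i + (c i - f c i)"
      using card_separating_shifts[OF assms(2), of "f c i" "c i"] by simp
  qed
  finally have "w * (\<Sum>s<w. card (M s)) \<le> w * D" by simp
  moreover have "(\<Sum>s<w. D) < (\<Sum>s<w. w * card (M s))"
    using gt assms(2) by (intro sum_strict_mono) auto
  ultimately show False by (simp add: sum_distrib_left)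
qed

text \<open>As many elements leave a class as enter it, so the elements that change class can be
  permuted among themselves to reach the classes prescribed by \<open>\<sigma>\<close>. The rest of
  \<open>\<sigma>\<close> then acts inside the classes.\<close>

lemma exists_coarse_permutation:
  fixes \<sigma> :: "'a \<Rightarrow> 'a" and a :: "'a \<Rightarrow> 'b"
  assumes "finite X" "bij_betw \<sigma> X X"
  shows "\<exists>\<tau>. bij_betw \<tau> X X \<and> (\<forall>x\<in>X. a (\<tau> x) = a (\<sigma> x)) \<and> (\<forall>x\<in>X. a (\<sigma> x) = a x \<longrightarrow> \<tau> x = x)"
proof -
  define M where "M = {x \<in> X. a (\<sigma> x) \<noteq> a x}"
  have fin: "finite {x \<in> X. P x}" for P using assms(1) by simp
  have fib: "card {x \<in> M. a x = v} = card {x \<in> M. a (\<sigma> x) = v}" for v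
  proof -
    have "\<sigma> ` {x \<in> X. a (\<sigma> x) = v} = {x \<in> \<sigma> ` X. a x = v}" by auto
    then have "\<sigma> ` {x \<in> X. a (\<sigma> x) = v} = {x \<in> X. a x = v}" using assms(2) by (simp add: bij_betw_def)
    moreover have "inj_on \<sigma> {x \<in> X. a (\<sigma> x) = v}" using assms(2) by (auto simp: bij_betw_def intro: inj_on_subset)
    ultimately have "card {x \<in> X. a x = v} = card {x \<in> X. a (\<sigma> x) = v}"
      using card_image[of \<sigma> "{x \<in> X. a (\<sigma> x) = v}"] by simp
    moreover have "{x \<in> M. a x = v} = {x \<in> X. a x = v} - {x \<in> X. a x = v \<and> a (\<sigma> x) = v}"
      "{x \<in> M. a (\<sigma> x) = v} = {x \<in> X. a (\<sigma> x) = v} - {x \<in> X. a x = v \<and> a (\<sigma> x) = v}"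
      by (auto simp: M_def)
    ultimately show ?thesis using fin by (simp add: card_Diff_subset subset_iff)
  qed
  have "finite M" using fin by (simp add: M_def)
  from relabelling_bijection[OF this, of a "\<lambda>x. a (\<sigma> x)", OF fib]
  obtain f where f: "bij_betw f M M" "\<forall>x\<in>M. a (f x) = a (\<sigma> x)" by blast
  define \<tau> where "\<tau> x = (if x \<in> M then f x else x)" for x
  have "bij_betw \<tau> (M \<union> (X - M)) (M \<union> (X - M))"
    unfolding \<tau>_def by (rule bij_betw_disjoint_Un) (use f in \<open>auto simp: bij_betw_id[unfolded id_def]\<close>)
  moreover have "M \<union> (X - M) = X" by (auto simp: M_def)
  ultimately have "bij_betw \<tau> X X" by simp
  moreover have "\<forall>x\<in>X. a (\<tau> x) = a (\<sigma> x)" using f by (auto simp: \<tau>_def M_def)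
  moreover have "\<forall>x\<in>X. a (\<sigma> x) = a x \<longrightarrow> \<tau> x = x" by (auto simp: \<tau>_def M_def)
  ultimately show ?thesis by blast
qed

section \<open>The discrete estimate\<close>

text \<open>Blocks have width \<open>2^k \<approx> max 1 (N \<epsilon>^(1/3))\<close>: moving the cubes that change blocks, and sorting
  inside the blocks, then both cost \<open>O(\<epsilon>^(1/3))\<close>.\<close>

lemma reaches_permutation:
  fixes \<sigma> :: "('n::finite \<Rightarrow> nat) \<Rightarrow> ('n \<Rightarrow> nat)" and t :: real
  assumes N: "N \<ge> 1" and \<sigma>: "bij_betw \<sigma> (cells N) (cells N)" and t: "t > 0"
    and dist: "(\<Sum>c\<in>cells N. \<Sum>i\<in>UNIV. (real (\<sigma> c i) - real (c i))\<^sup>2) \<le> t ^ 6 * real N ^ (CARD('n) + 2)"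
  shows "reaches N \<sigma> (40 * (real CARD('n))\<^sup>2 * t)"
proof -
  define \<nu> where "\<nu> = CARD('n)"
  define C where "C = (cells N :: ('n \<Rightarrow> nat) set)"
  define u where "u = real N powr (- 1 - real CARD('n) / 2)"
  have \<nu>: "\<nu> \<ge> 1" by (simp add: \<nu>_def Suc_le_eq)
  have cardC: "card C = N ^ \<nu>" by (simp add: C_def \<nu>_def card_cells)
  have N0: "real N > 0" using N by simp
  \<comment> \<open>If \<open>N ^ \<nu>\<close> couples are allowed for, a movement with arrays of
    \<open>l\<close> cubes is charged their Euclidean length \<open>l / N\<close>.\<close>
  have u: "u * sqrt (real N ^ \<nu>) = 1 / real N" "u > 0"
  proof -
    have "sqrt (real N ^ \<nu>) = real N powr (real \<nu> / 2)"
      using N0 by (simp add: powr_half_sqrt[symmetric] powr_realpow[symmetric] powr_powr)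
    then have "u * sqrt (real N ^ \<nu>) = real N powr - 1"
      unfolding u_def \<nu>_def using N0 by (simp add: powr_add[symmetric])
    then show "u * sqrt (real N ^ \<nu>) = 1 / real N" using N0 by (simp add: powr_minus_divide)
    show "u > 0" using N0 by (simp add: u_def)
  qed
  \<comment> \<open>Here \<open>t\<close> plays the role of \<open>\<epsilon>^(1/3)\<close>. For
    \<open>real N * t \<le> 1\<close> this gives \<open>k = 0\<close>: the blocks are single
    cells.\<close>
  define y where "y = max 1 (real N * t)"
  have "nat \<lfloor>y\<rfloor> \<ge> 1" by (simp add: y_def le_nat_floor)
  then obtain k where k: "2 ^ k \<le> nat \<lfloor>y\<rfloor>" "nat \<lfloor>y\<rfloor> < 2 ^ (k + 1)"
    using ex_power_ivl1[of 2 "nat \<lfloor>y\<rfloor>"] by auto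
  have y0: "y \<ge> 0" by (simp add: y_def)
  have k1: "(2::real) ^ k \<le> y"
  proof -
    have "(2::real) ^ k = real (2 ^ k)" by simp
    also have "\<dots> \<le> real (nat \<lfloor>y\<rfloor>)" using k(1) by (simp only: of_nat_le_iff)
    also have "\<dots> \<le> y" using y0 by simp
    finally show ?thesis .
  qed
  have k2: "y < 2 * 2 ^ k"
  proof -
    have "y < real (nat \<lfloor>y\<rfloor> + 1)" using y0 by linarith
    also have "\<dots> \<le> real (2 ^ (k + 1))" using k(2) by (simp only: of_nat_le_iff)
    finally show ?thesis by simp
  qed
  \<comment> \<open>With shift 0, one block of width \<open>2 ^ K\<close> contains all coordinates,
    so the first stage is routed without restriction.\<close>
  obtain K where K: "N \<le> 2 ^ K" "(2::nat) ^ K \<le> 2 * N"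
  proof -
    obtain n where "2 ^ n \<le> N" "N < 2 ^ (n + 1)" using ex_power_ivl1[of 2 N] N by auto
    then show ?thesis by (intro that[of "n + 1"]) auto
  qed
  define D where "D = (\<Sum>c\<in>C. \<Sum>i\<in>UNIV. (\<sigma> c i - c i) + (c i - \<sigma> c i))"
  obtain s where s: "2 ^ k * card {c \<in> C. \<exists>i. (\<sigma> c i + s) div 2 ^ k \<noteq> (c i + s) div 2 ^ k} \<le> D"
    using exists_good_shift[of C "2 ^ k" \<sigma>] unfolding D_def C_def by auto
  define m where "m = card {c \<in> C. \<exists>i. (\<sigma> c i + s) div 2 ^ k \<noteq> (c i + s) div 2 ^ k}"
  have D: "real D \<le> real \<nu> * t ^ 3 * real N ^ (\<nu> + 1)"
  proof (rule power2_le_imp_le)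
    define d where "d = (\<lambda>(c, i). \<bar>real (\<sigma> c i) - real (c i)\<bar>)"
    have D': "real D = (\<Sum>p\<in>C \<times> UNIV. d p)"
      unfolding D_def d_def sum.cartesian_product[symmetric] of_nat_sum
      by (intro sum.cong refl) (auto simp: of_nat_diff abs_if)
    have "(real D)\<^sup>2 \<le> (\<Sum>p\<in>C \<times> (UNIV :: 'n set). 1\<^sup>2) * (\<Sum>p\<in>C \<times> UNIV. (d p)\<^sup>2)"
      unfolding D' using Cauchy_Schwarz_ineq_sum[of "\<lambda>_. 1" d "C \<times> (UNIV :: 'n set)"] by simp
    also have "(\<Sum>p\<in>C \<times> UNIV. (d p)\<^sup>2) = (\<Sum>c\<in>C. \<Sum>i\<in>UNIV. (real (\<sigma> c i) - real (c i))\<^sup>2)"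
      by (simp add: sum.cartesian_product d_def split_def)
    also have "(\<Sum>p\<in>C \<times> (UNIV :: 'n set). 1\<^sup>2) = real (N ^ \<nu> * \<nu>)"
      by (simp add: cardC card_cartesian_product \<nu>_def)
    also have "real (N ^ \<nu> * \<nu>) * (\<Sum>c\<in>C. \<Sum>i\<in>UNIV. (real (\<sigma> c i) - real (c i))\<^sup>2)
      \<le> real (N ^ \<nu> * \<nu>) * (t ^ 6 * real N ^ (\<nu> + 2))"
      using dist unfolding C_def \<nu>_def by (intro mult_left_mono) auto
    \<comment> \<open>The additional factor \<open>real \<nu>\<close> turns the bound into a perfect
      square.\<close>
    also have "\<dots> \<le> real (N ^ \<nu> * \<nu>) * (t ^ 6 * real N ^ (\<nu> + 2)) * real \<nu>"
      using mult_left_mono[of 1 "real \<nu>" "real (N ^ \<nu> * \<nu>) * (t ^ 6 * real N ^ (\<nu> + 2))"] \<nu> t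
      by (simp del: of_nat_mult of_nat_power)
    also have "\<dots> = (real \<nu> * t ^ 3 * real N ^ (\<nu> + 1))\<^sup>2"
      by (simp add: power_mult_distrib power2_eq_square power_add algebra_simps eval_nat_numeral)
    finally show "(real D)\<^sup>2 \<le> (real \<nu> * t ^ 3 * real N ^ (\<nu> + 1))\<^sup>2" .
    show "0 \<le> real \<nu> * t ^ 3 * real N ^ (\<nu> + 1)" using t by simp
  qed
  \<comment> \<open>From \<open>m \<le> D / 2 ^ k\<close> and \<open>2 ^ k > real N * t / 2\<close>:
    the moved fraction is of order \<open>t\<^sup>2\<close>, and its root of order
    \<open>t\<close>.\<close>
  have m: "real m \<le> 2 * real \<nu> * t\<^sup>2 * real N ^ \<nu>"
  proof -
    have "real N * t * real m \<le> y * real m" by (intro mult_right_mono) (auto simp: y_def)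
    also have "\<dots> \<le> 2 * 2 ^ k * real m" using k2 by (intro mult_right_mono) auto
    also have "\<dots> = 2 * real (2 ^ k * m)" by simp
    also have "\<dots> \<le> 2 * real D" using s by (simp only: m_def of_nat_le_iff mult_le_cancel_left_pos zero_less_numeral)
    also have "\<dots> \<le> 2 * (real \<nu> * t ^ 3 * real N ^ (\<nu> + 1))" using D by simp
    also have "\<dots> = real N * t * (2 * real \<nu> * t\<^sup>2 * real N ^ \<nu>)"
      by (simp add: power2_eq_square power3_eq_cube algebra_simps)
    finally show ?thesis using N0 t by (simp add: mult_le_cancel_left_pos)
  qed
  obtain \<tau> where \<tau>: "bij_betw \<tau> C C"
    "\<forall>c\<in>C. (\<lambda>i. (\<tau> c i + s) div 2 ^ k) = (\<lambda>i. (\<sigma> c i + s) div 2 ^ k)"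
    "\<forall>c\<in>C. (\<lambda>i. (\<sigma> c i + s) div 2 ^ k) = (\<lambda>i. (c i + s) div 2 ^ k) \<longrightarrow> \<tau> c = c"
    using exists_coarse_permutation[of C \<sigma> "\<lambda>c i. (c i + s) div 2 ^ k"] \<sigma> unfolding C_def by auto
  \<comment> \<open>The remaining permutation of \<open>\<sigma> = \<rho> \<circ> \<tau>\<close>
    stays inside the blocks, because \<open>\<tau>\<close> and \<open>\<sigma>\<close> send each
    cell to the same block.\<close>
  define \<rho> where "\<rho> = \<sigma> \<circ> inv_into C \<tau>"
  have \<rho>\<tau>: "\<rho> (\<tau> c) = \<sigma> c" if "c \<in> C" for c
    using \<tau>(1) that by (simp add: \<rho>_def bij_betw_def)
  have \<rho>: "bij_betw \<rho> C C"
    unfolding \<rho>_def using bij_betw_trans[OF bij_betw_inv_into[OF \<tau>(1)]] \<sigma> by (simp add: C_def)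
  have "reaches N \<tau> (real (4 * card (UNIV :: 'n set)) * (2 * (2 ^ K - 1) * real N powr (- 1 - real CARD('n) / 2) * sqrt (real m)))"
  proof (rule reaches_block_permutation[OF N, where s = 0])
    show "bij_betw \<tau> (cells N) (cells N)" using \<tau>(1) by (simp add: C_def)
    show "(\<tau> c j + 0) div 2 ^ K = (c j + 0) div 2 ^ K" if "c \<in> cells N" for c j
    proof -
      have "\<tau> c \<in> cells N" using \<tau>(1) that by (auto simp: C_def bij_betw_def)
      then have "\<tau> c j < 2 ^ K" "c j < 2 ^ K" using that K(1) by (auto simp: cells_def intro: less_le_trans)
      then show ?thesis by simp
    qed
    have "{c \<in> C. \<tau> c \<noteq> c} \<subseteq> {c \<in> C. \<exists>i. (\<sigma> c i + s) div 2 ^ k \<noteq> (c i + s) div 2 ^ k}"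
      using \<tau>(3) by (auto simp: fun_eq_iff)
    then show "card {c \<in> cells N. \<tau> c \<noteq> c} \<le> m" unfolding m_def C_def by (intro card_mono) auto
  qed auto
  \<comment> \<open>The constant 32 is the product of \<open>4 * \<nu>\<close> for the phases,
    \<open>4 * N\<close> for the array lengths and \<open>2 * \<nu> * t / N\<close> for the moved
    cells. With the 8 of the second stage it gives 40.\<close>
  moreover have "real (4 * card (UNIV :: 'n set)) * (2 * (2 ^ K - 1) * real N powr (- 1 - real CARD('n) / 2) * sqrt (real m))
    \<le> 32 * (real \<nu>)\<^sup>2 * t"
  proof -
    have "sqrt (real m) \<le> sqrt (2 * real \<nu> * t\<^sup>2 * real N ^ \<nu>)" using m by simp
    also have "\<dots> = sqrt (2 * real \<nu>) * t * sqrt (real N ^ \<nu>)" using t by (simp add: real_sqrt_mult)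
    also have "\<dots> \<le> 2 * real \<nu> * t * sqrt (real N ^ \<nu>)"
    proof (intro mult_right_mono)
      have "2 * real \<nu> \<le> (2 * real \<nu>)\<^sup>2" using \<nu> by (simp add: power2_eq_square)
      then show "sqrt (2 * real \<nu>) \<le> 2 * real \<nu>" by (simp add: real_le_lsqrt)
    qed (use t in auto)
    finally have "u * sqrt (real m) \<le> u * (2 * real \<nu> * t * sqrt (real N ^ \<nu>))"
      using u(2) by (intro mult_left_mono) auto
    also have "\<dots> = 2 * real \<nu> * t * (u * sqrt (real N ^ \<nu>))" by (simp only: ac_simps)
    finally have sm: "u * sqrt (real m) \<le> 2 * real \<nu> * t / real N" by (simp add: u(1))
    have "2 ^ K - 1 \<le> 2 * real N"
    proof -
      have "real (2 ^ K) \<le> real (2 * N)" using K(2) by (simp only: of_nat_le_iff)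
      then show ?thesis by simp
    qed
    then have "2 * (2 ^ K - 1) * (u * sqrt (real m)) \<le> 2 * (2 * real N) * (2 * real \<nu> * t / real N)"
      using sm u(2) by (intro mult_mono) auto
    also have "\<dots> = 8 * real \<nu> * t" using N0 by simp
    finally have "real (4 * \<nu>) * (2 * (2 ^ K - 1) * (u * sqrt (real m))) \<le> real (4 * \<nu>) * (8 * real \<nu> * t)"
      by (intro mult_left_mono) auto
    then show ?thesis by (simp add: \<nu>_def u_def power2_eq_square mult.assoc algebra_simps)
  qed
  ultimately have r\<tau>: "reaches N \<tau> (32 * (real \<nu>)\<^sup>2 * t)" by (rule reaches_cong[OF _ refl])
  have "reaches N \<rho> (real (4 * card (UNIV :: 'n set)) * (2 * (2 ^ k - 1) * real N powr (- 1 - real CARD('n) / 2) * sqrt (real (card C))))"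
  proof (rule reaches_block_permutation[OF N, where s = s])
    show "bij_betw \<rho> (cells N) (cells N)" using \<rho> by (simp add: C_def)
    show "(\<rho> c j + s) div 2 ^ k = (c j + s) div 2 ^ k" if c: "c \<in> cells N" for c j
    proof -
      have "c \<in> \<tau> ` C" using \<tau>(1) c by (simp add: C_def bij_betw_def)
      then obtain d where d: "d \<in> C" "c = \<tau> d" by blast
      then show ?thesis using fun_cong[OF bspec[OF \<tau>(2) d(1)], of j] \<rho>\<tau>[OF d(1)] by simp
    qed
    show "card {c \<in> cells N. \<rho> c \<noteq> c} \<le> card C" unfolding C_def by (intro card_mono) auto
  qed auto
  moreover have "real (4 * card (UNIV :: 'n set)) * (2 * (2 ^ k - 1) * real N powr (- 1 - real CARD('n) / 2) * sqrt (real (card C)))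
    \<le> 8 * (real \<nu>)\<^sup>2 * t"
  proof -
    \<comment> \<open>The \<open>- 1\<close> in the cost of sorting is essential here: for
      \<open>real N * t \<le> 1\<close> the left side vanishes, whereas \<open>2 ^ k = 1\<close>
      would not be bounded by \<open>real N * t\<close>.\<close>
    have "(2::real) ^ k - 1 \<le> real N * t"
      using k1 t N0 by (cases "real N * t \<le> 1") (auto simp: y_def intro: order_trans[of _ 0])
    then have "8 * real \<nu> * ((2 ^ k - 1) / real N) \<le> 8 * real \<nu> * t"
      using N0 by (intro mult_left_mono) (auto simp: field_simps)
    also have "\<dots> \<le> 8 * (real \<nu>)\<^sup>2 * t" using \<nu> t by (simp add: power2_eq_square)
    finally have "real (4 * \<nu>) * (2 * (2 ^ k - 1) * (u * sqrt (real N ^ \<nu>))) \<le> 8 * (real \<nu>)\<^sup>2 * t"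
      unfolding u(1) by (simp add: algebra_simps diff_divide_distrib)
    then show ?thesis by (simp add: cardC u_def \<nu>_def mult.assoc)
  qed
  ultimately have r\<rho>: "reaches N \<rho> (8 * (real \<nu>)\<^sup>2 * t)" by (rule reaches_cong[OF _ refl])
  show ?thesis
    by (rule reaches_cong[OF reaches_comp[OF N r\<tau> r\<rho>]]) (use \<rho>\<tau> in \<open>auto simp: C_def \<nu>_def\<close>)
qed

section \<open>Cube permutations of the unit cube\<close>

lemma interior_cube_eq_box:
  "interior (cube N c) = box (cell_vec c /\<^sub>R real N) ((cell_vec c + 1) /\<^sub>R real N)"
  by (auto simp: mem_interior_cube mem_box_cart cell_vec_def divide_inverse mult.commute)

lemma interior_cube_subset_unit_cube:
  assumes "N \<ge> 1" "c \<in> cells N"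
  shows "interior (cube N c) \<subseteq> unit_cube"
proof
  fix x assume x: "x \<in> interior (cube N c)"
  have "0 \<le> x $ i \<and> x $ i \<le> 1" for i
  proof -
    have "real (c i) / real N < x $ i" "x $ i < (real (c i) + 1) / real N"
      using x by (auto simp: mem_interior_cube)
    moreover have "c i < N" using assms by (simp add: cells_def)
    then have "(real (c i) + 1) / real N \<le> 1" by simp
    moreover have "0 \<le> real (c i) / real N" by simp
    ultimately show ?thesis by linarith
  qed
  then show "x \<in> unit_cube" by (simp add: mem_box_cart)
qed

text \<open>The exceptional points lie on finitely many hyperplanes, on which some coordinate is a
  multiple of \<open>1 / N\<close>.\<close>

lemma AE_interior_cube:
  assumes "N \<ge> 1"
  shows "AE x in lebesgue_on (unit_cube :: (real^'n::finite) set). \<exists>c\<in>cells N. x \<in> interior (cube N c)"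
proof -
  define H where "H = (\<Union>i. \<Union>k\<in>{..N}. {x :: real^'n. x $ i = real k / real N})"
  have hyp: "negligible {x :: real^'n. x $ i = a}" for i a
    using negligible_standard_hyperplane[of "axis i 1 :: real^'n" a] by (simp add: cart_eq_inner_axis)
  have "negligible (\<Union>k\<in>{..N}. {x :: real^'n. x $ i = real k / real N})" for i
    by (rule negligible_Union) (auto simp: hyp)
  then have "negligible H" unfolding H_def by (intro negligible_Union) auto
  then have "AE x in lebesgue. x \<notin> H" by (intro AE_not_in) (simp add: negligible_iff_null_sets)
  moreover have "\<exists>c\<in>cells N. x \<in> interior (cube N c)" if x: "x \<in> unit_cube" "x \<notin> H" for x :: "real^'n"
  proof
    define c where "c = (\<lambda>i. nat \<lfloor>x $ i * real N\<rfloor>)"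
    have c: "real (c i) < x $ i * real N \<and> x $ i * real N < real (c i) + 1 \<and> c i < N" for i
    proof -
      have x01: "0 \<le> x $ i" "x $ i \<le> 1" using x(1) by (auto simp: mem_box_cart)
      have ne: "x $ i * real N \<noteq> real k" if "k \<le> N" for k
        using x(2) that assms by (auto simp: H_def field_simps)
      have nonneg: "0 \<le> x $ i * real N" using x01 by simp
      have le: "x $ i * real N \<le> real N" using x01 by (simp add: mult_left_le_one_le)
      have 1: "real (c i) \<le> x $ i * real N" "x $ i * real N < real (c i) + 1"
        using nonneg unfolding c_def by linarith+
      then have "c i \<le> N" using le by linarith
      then have "real (c i) < x $ i * real N" "x $ i * real N < real N"
        using 1 le ne[of "c i"] ne[of N] by linarith+
      with 1 show ?thesis by linarith
    qed
    show "c \<in> cells N" using c by (simp add: cells_def)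
    show "x \<in> interior (cube N c)" using c assms by (simp add: mem_interior_cube field_simps)
  qed
  ultimately show ?thesis by (subst AE_restrict_space_iff) auto
qed

lemma interior_cube_sets:
  assumes "N \<ge> 1" "c \<in> cells N"
  shows "interior (cube N c) \<in> sets (lebesgue_on unit_cube)"
    and "measure (lebesgue_on unit_cube) (interior (cube N (c :: 'n::finite \<Rightarrow> nat))) = 1 / real N ^ CARD('n)"
proof -
  have sub: "interior (cube N c) \<subseteq> unit_cube" using interior_cube_subset_unit_cube[OF assms] .
  then show "interior (cube N c) \<in> sets (lebesgue_on unit_cube)"
    by (simp add: sets_restrict_space_iff interior_cube_eq_box)
  let ?l = "cell_vec c /\<^sub>R real N" and ?u = "(cell_vec c + 1) /\<^sub>R real N"
  have le: "\<forall>i. ?l $ i \<le> ?u $ i" by (simp add: mult_left_mono)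
  have "measure (lebesgue_on unit_cube) (interior (cube N c)) = measure lebesgue (interior (cube N c))"
    using sub by (subst measure_restrict_space) auto
  also have "\<dots> = measure lborel (box ?l ?u)" unfolding interior_cube_eq_box by simp
  also have "\<dots> = measure lborel (cbox ?l ?u)" by (simp only: measure_lborel_box_eq measure_lborel_cbox_eq)
  also have "\<dots> = (\<Prod>i\<in>UNIV. ?u $ i - ?l $ i)"
    by (rule content_cbox_cart) (use le in \<open>simp add: interval_ne_empty_cart\<close>)
  also have "\<dots> = 1 / real N ^ CARD('n)"
    by (simp add: scaleR_right_diff_distrib[symmetric] algebra_simps divide_inverse power_inverse)
  finally show "measure (lebesgue_on unit_cube) (interior (cube N c)) = 1 / real N ^ CARD('n)" .
qed

text \<open>If two cubes had the same image, the preimage of its interior would have at least twice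
  the measure of a cube, against measure preservation.\<close>

lemma cube_perms_acts:
  fixes P :: "real^'n::finite \<Rightarrow> real^'n"
  assumes N: "N \<ge> 1" and P: "P \<in> cube_perms N"
  shows "\<exists>f. bij_betw f (cells N) (cells N) \<and> acts N P f"
proof -
  let ?M = "lebesgue_on (unit_cube :: (real^'n) set)"
  interpret finite_measure ?M by (rule finite_measure_lebesgue_on) simp
  have mp: "P \<in> ?M \<rightarrow>\<^sub>M ?M" "distr ?M ?M P = ?M" using P by (auto simp: cube_perms_def measure_preserving_def)
  have "\<exists>d\<in>cells N. \<forall>x\<in>interior (cube N c). P x = x + (cell_vec d - cell_vec c) /\<^sub>R real N" if c: "c \<in> cells N" for c
  proof -
    have "cube N c \<in> tiling N" using c by (simp add: tiling_eq)
    then obtain \<kappa>' where "\<kappa>' \<in> tiling N" "\<forall>x\<in>interior (cube N c). P x = x + center \<kappa>' - center (cube N c)"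
      using P unfolding cube_perms_def by blast
    then show ?thesis unfolding tiling_eq center_cube_diff[symmetric] by (auto simp: add_diff_eq)
  qed
  then obtain f where f: "\<And>c. c \<in> cells N \<Longrightarrow> f c \<in> cells N"
    "\<And>c x. c \<in> cells N \<Longrightarrow> x \<in> interior (cube N c) \<Longrightarrow> P x = x + (cell_vec (f c) - cell_vec c) /\<^sub>R real N"
    by metis
  have "inj_on f (cells N)"
  proof (rule inj_onI, rule ccontr)
    fix c d assume cd: "c \<in> cells N" "d \<in> cells N" "f c = f d" "c \<noteq> d"
    define A where "A = interior (cube N (f c))"
    define v where "v = 1 / real N ^ CARD('n)"
    have v: "v > 0" using N by (simp add: v_def)
    have A: "A \<in> sets ?M" "measure ?M A = v"
      using interior_cube_sets[OF N f(1)[OF cd(1)]] by (auto simp: A_def v_def)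
    have sub: "interior (cube N e) \<subseteq> P -` A \<inter> space ?M" if "e \<in> {c, d}" for e
    proof
      fix x assume x: "x \<in> interior (cube N e)"
      have e: "e \<in> cells N" "f e = f c" using that cd by auto
      have "P x \<in> A" unfolding A_def f(2)[OF e(1) x] e(2)[symmetric] by (rule interior_cube_shift[OF N x])
      moreover have "x \<in> space ?M" using interior_cube_subset_unit_cube[OF N e(1)] x by auto
      ultimately show "x \<in> P -` A \<inter> space ?M" by simp
    qed
    have "2 * v = measure ?M (interior (cube N c) \<union> interior (cube N d))"
      using interior_cube_sets[OF N cd(1)] interior_cube_sets[OF N cd(2)] interior_cube_disjoint[OF N] cd(4)
      by (subst finite_measure_Union) (auto simp: v_def)
    also have "\<dots> \<le> measure ?M (P -` A \<inter> space ?M)"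
      using sub measurable_sets[OF mp(1) A(1)] by (intro finite_measure_mono) auto
    also have "\<dots> = measure (distr ?M ?M P) A" by (rule measure_distr[OF mp(1) A(1), symmetric])
    also have "\<dots> = v" unfolding mp(2) by (rule A(2))
    finally show False using v by simp
  qed
  moreover have "f ` cells N = cells N" using calculation f(1) by (intro endo_inj_surj) auto
  ultimately have "bij_betw f (cells N) (cells N)" by (simp add: bij_betw_def)
  then show ?thesis using f unfolding acts_def by blast
qed

text \<open>The integrand is almost everywhere constant on each cube. Of the exponent,
  \<open>CARD('n)\<close> is due to the volume of a cube and 2 to the squared side
  \<open>1 / N\<close> of the displacement.\<close>

lemma L2_dist_eq:
  fixes P Q :: "real^'n::finite \<Rightarrow> real^'n"
  assumes N: "N \<ge> 1" and P: "P \<in> cube_perms N" and Q: "Q \<in> cube_perms N"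
    and f: "acts N P f" and g: "acts N Q g"
  shows "(L2_dist P Q)\<^sup>2 * real N ^ (CARD('n) + 2) = (\<Sum>c\<in>cells N. \<Sum>i\<in>UNIV. (real (f c i) - real (g c i))\<^sup>2)"
proof -
  let ?M = "lebesgue_on (unit_cube :: (real^'n) set)"
  interpret finite_measure ?M by (rule finite_measure_lebesgue_on) simp
  define w where "w c = (norm ((cell_vec (f c) - cell_vec (g c)) /\<^sub>R real N))\<^sup>2" for c
  define F where "F x = (norm (P x - Q x))\<^sup>2" for x
  define G where "G x = (\<Sum>c\<in>cells N. w c * indicator (interior (cube N c)) x)" for x
  \<comment> \<open>Measure preservation provides measurability with respect to the Lebesgue sets of
    the unit cube; composition with the identity turns it into Borel measurability.\<close>
  have borel: "R \<in> borel_measurable ?M" if "R \<in> cube_perms N" for R :: "real^'n \<Rightarrow> real^'n"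
  proof -
    have "R \<in> ?M \<rightarrow>\<^sub>M ?M" using that by (simp add: cube_perms_def measure_preserving_def)
    then have "id \<circ> R \<in> borel_measurable ?M" by (rule measurable_comp[OF _ id_borel_measurable_lebesgue_on])
    then show ?thesis by simp
  qed
  have cubes: "interior (cube N c) \<in> sets ?M" if "c \<in> cells N" for c
    using interior_cube_sets(1)[OF N that] .
  have "AE x in ?M. F x = G x"
    using AE_interior_cube[OF N]
  proof eventually_elim
    case (elim x)
    then obtain c where c: "c \<in> cells N" "x \<in> interior (cube N c)" by blast
    have "P x - Q x = (cell_vec (f c) - cell_vec (g c)) /\<^sub>R real N"
      using f g c by (simp add: acts_def scaleR_right_diff_distrib)
    then have "F x = w c" by (simp add: F_def w_def)
    moreover have "x \<in> interior (cube N d) \<longleftrightarrow> d = c" for d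
      using interior_cube_disjoint[OF N c(2)] c(2) by blast
    then have "G x = (\<Sum>d\<in>cells N. if d = c then w d else 0)"
      unfolding G_def by (intro sum.cong) (auto simp: indicator_def)
    ultimately show ?case using c(1) by simp
  qed
  moreover have "F \<in> borel_measurable ?M" unfolding F_def using borel[OF P] borel[OF Q] by measurable
  moreover have "G \<in> borel_measurable ?M" unfolding G_def using cubes by measurable
  ultimately have "integral\<^sup>L ?M F = integral\<^sup>L ?M G" by (intro integral_cong_AE)
  also have "\<dots> = (\<Sum>c\<in>cells N. w c * measure ?M (interior (cube N c)))"
  proof -
    have i1: "integrable ?M (\<lambda>x. w c * indicator (interior (cube N c)) x)" if "c \<in> cells N" for c
      by (intro integrable_mult_right integrable_real_indicator cubes that) (simp add: emeasure_eq_measure)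
    have i2: "(LINT x|?M. w c * indicator (interior (cube N c)) x) = w c * measure ?M (interior (cube N c))"
      if "c \<in> cells N" for c
    proof -
      have "interior (cube N c) \<inter> space ?M = interior (cube N c)"
        using sets.sets_into_space[OF cubes[OF that]] by blast
      then show ?thesis by simp
    qed
    have "integral\<^sup>L ?M G = (\<Sum>c\<in>cells N. LINT x|?M. w c * indicator (interior (cube N c)) x)"
      unfolding G_def by (rule Bochner_Integration.integral_sum) (rule i1)
    also have "\<dots> = (\<Sum>c\<in>cells N. w c * measure ?M (interior (cube N c)))"
      by (intro sum.cong refl i2)
    finally show ?thesis .
  qed
  also have "\<dots> = (\<Sum>c\<in>cells N. w c) / real N ^ CARD('n)"
    by (simp add: interior_cube_sets(2)[OF N] sum_divide_distrib)
  finally have int: "integral\<^sup>L ?M F = (\<Sum>c\<in>cells N. w c) / real N ^ CARD('n)" .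
  have w: "w c = (\<Sum>i\<in>UNIV. (real (f c i) - real (g c i))\<^sup>2) / (real N)\<^sup>2" for c
    unfolding w_def norm_vec_def L2_set_def
    by (simp add: cell_vec_def sum_nonneg power_mult_distrib sum_distrib_left divide_inverse mult.commute power_inverse)
  have "(\<Sum>c\<in>cells N. w c) \<ge> 0" by (intro sum_nonneg) (simp add: w_def)
  then have "(L2_dist P Q)\<^sup>2 = (\<Sum>c\<in>cells N. w c) / real N ^ CARD('n)"
    unfolding L2_dist_def F_def[symmetric] int by simp
  also have "\<dots> * real N ^ (CARD('n) + 2) = (\<Sum>c\<in>cells N. w c) * (real N)\<^sup>2"
    using N by (simp add: power_add power2_eq_square)
  also have "\<dots> = (\<Sum>c\<in>cells N. \<Sum>i\<in>UNIV. (real (f c i) - real (g c i))\<^sup>2)"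
    using N by (simp add: w sum_divide_distrib[symmetric])
  finally show ?thesis .
qed

lemma connects_reaching_flow:
  fixes P Q :: "real^'n::finite \<Rightarrow> real^'n"
  assumes N: "N \<ge> 1" and f: "acts N P f" and g: "acts N Q g"
    and Zs: "acts N (fold (movement_map N) Zs) \<sigma>" and \<sigma>: "\<And>c. c \<in> cells N \<Longrightarrow> \<sigma> (f c) = g c"
  shows "connects N Zs P Q"
  unfolding connects_def using AE_interior_cube[OF N]
proof eventually_elim
  case (elim x)
  then obtain c where c: "c \<in> cells N" "x \<in> interior (cube N c)" by blast
  have "fold (movement_map N) Zs (P x) = x + (cell_vec (\<sigma> (f c)) - cell_vec c) /\<^sub>R real N"
    using acts_comp[OF N f Zs] c by (simp add: acts_def)
  then show ?case using g c \<sigma> by (simp add: acts_def)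
qed

lemma flow_dist_le_L2_dist:
  fixes P Q :: "real^'n::finite \<Rightarrow> real^'n"
  assumes N: "N \<ge> 1" and P: "P \<in> cube_perms N" and Q: "Q \<in> cube_perms N"
  shows "flow_dist N P Q \<le> 40 * (real CARD('n))\<^sup>2 * L2_dist P Q powr (1 / 3)"
proof -
  obtain f where f: "bij_betw f (cells N) (cells N)" "acts N P f" using cube_perms_acts[OF N P] by blast
  obtain g where g: "bij_betw g (cells N) (cells N)" "acts N Q g" using cube_perms_acts[OF N Q] by blast
  define \<sigma> where "\<sigma> = g \<circ> inv_into (cells N) f"
  have \<sigma>f: "\<sigma> (f c) = g c" if "c \<in> cells N" for c
    using f(1) that by (simp add: \<sigma>_def bij_betw_def)
  have \<sigma>: "bij_betw \<sigma> (cells N) (cells N)"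
    unfolding \<sigma>_def by (rule bij_betw_trans[OF bij_betw_inv_into[OF f(1)] g(1)])
  define t where "t = L2_dist P Q powr (1 / 3)"
  have nonneg: "L2_dist P Q \<ge> 0" by (simp add: L2_dist_def)
  \<comment> \<open>Reindexing by \<open>f\<close> turns the displacement of \<open>\<sigma>\<close>
    at \<open>f c\<close> into the difference of \<open>g c\<close> and \<open>f c\<close>.\<close>
  have "(\<Sum>c\<in>cells N. \<Sum>i\<in>UNIV. (real (\<sigma> c i) - real (c i))\<^sup>2) =
    (\<Sum>c\<in>cells N. \<Sum>i\<in>UNIV. (real (\<sigma> (f c) i) - real (f c i))\<^sup>2)"
    by (rule sum.reindex_bij_betw[OF f(1), symmetric])
  also have "\<dots> = (\<Sum>c\<in>cells N. \<Sum>i\<in>UNIV. (real (f c i) - real (g c i))\<^sup>2)"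
    using \<sigma>f by (intro sum.cong) (auto simp: power2_commute)
  finally have dist: "(\<Sum>c\<in>cells N. \<Sum>i\<in>UNIV. (real (\<sigma> c i) - real (c i))\<^sup>2) =
    (L2_dist P Q)\<^sup>2 * real N ^ (CARD('n) + 2)"
    using L2_dist_eq[OF N P Q f(2) g(2)] by simp
  have "reaches N \<sigma> (40 * (real CARD('n))\<^sup>2 * t)"
  \<comment> \<open>\<open>reaches_permutation\<close> takes a positive \<open>t\<close>. At
    distance 0 the right-hand side is 0, and \<open>\<sigma>\<close> is the identity on the cells,
    so the empty flow serves.\<close>
  proof (cases "L2_dist P Q = 0")
    case True
    have "\<sigma> c = c" if c: "c \<in> cells N" for c
    proof
      fix i
      have "(\<Sum>c\<in>cells N. \<Sum>i\<in>UNIV. (real (\<sigma> c i) - real (c i))\<^sup>2) = 0" using dist True by simp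
      then have "(real (\<sigma> c i) - real (c i))\<^sup>2 = 0" using c by (simp add: sum_nonneg_eq_0_iff sum_nonneg)
      then show "\<sigma> c i = c i" by simp
    qed
    then have "reaches N \<sigma> 0" by (rule reaches_id)
    then show ?thesis using True by (simp add: t_def)
  next
    case False
    then have pos: "L2_dist P Q > 0" using nonneg by simp
    then have t: "t > 0" by (simp add: t_def)
    have "t ^ 6 = t powr 6" using t by simp
    also have "\<dots> = L2_dist P Q powr 2" by (simp add: t_def powr_powr)
    also have "\<dots> = (L2_dist P Q)\<^sup>2" using pos by simp
    finally have "t ^ 6 = (L2_dist P Q)\<^sup>2" .
    with t show ?thesis using reaches_permutation[OF N \<sigma>, of t] dist by simp
  qed
  then obtain Zs :: "'n movement list" where Zs: "discrete_flow N Zs"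
    "flow_length N Zs \<le> 40 * (real CARD('n))\<^sup>2 * t" "acts N (fold (movement_map N) Zs) \<sigma>"
    unfolding reaches_def by blast
  have "connects N Zs P Q" by (rule connects_reaching_flow[OF N f(2) g(2) Zs(3)]) (rule \<sigma>f)
  then have "flow_dist N P Q \<le> flow_length N Zs" by (rule flow_dist_le_flow_length[OF N Zs(1)])
  then show ?thesis using Zs(2) by (simp add: t_def)
qed

theorem theorem1p3:
  shows "(CARD('n::finite) \<ge> 3 \<longrightarrow>
      (\<exists>C>0. \<exists>\<alpha>\<ge>1 / (1 + real CARD('n)). \<forall>N\<ge>1.
        \<forall>P\<in>cube_perms N. \<forall>Q\<in>cube_perms N.
          flow_dist N (P :: real^'n \<Rightarrow> real^'n) Q \<le> C * L2_dist P Q powr \<alpha>)) \<and>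
    (CARD('n) = 2 \<longrightarrow>
      (\<exists>C>0. \<exists>\<alpha>\<ge>2 / 7. \<forall>N\<ge>1.
        \<forall>P\<in>cube_perms N. \<forall>Q\<in>cube_perms N.
          flow_dist N (P :: real^'n \<Rightarrow> real^'n) Q \<le> C * L2_dist P Q powr \<alpha>))"
proof -
  define C where "C = 40 * (real CARD('n))\<^sup>2"
  have C: "C > 0" by (simp add: C_def)
  have bound: "\<forall>N\<ge>1. \<forall>P\<in>cube_perms N. \<forall>Q\<in>cube_perms N.
      flow_dist N (P :: real^'n \<Rightarrow> real^'n) Q \<le> C * L2_dist P Q powr (1 / 3)"
    unfolding C_def using flow_dist_le_L2_dist by blast
  show ?thesis
  proof (intro conjI impI)
    assume "CARD('n) \<ge> 3"
    then have le: "1 / (1 + real CARD('n)) \<le> 1 / 3" by (simp add: field_simps)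
    show "\<exists>C>0. \<exists>\<alpha>\<ge>1 / (1 + real CARD('n)). \<forall>N\<ge>1.
        \<forall>P\<in>cube_perms N. \<forall>Q\<in>cube_perms N.
          flow_dist N (P :: real^'n \<Rightarrow> real^'n) Q \<le> C * L2_dist P Q powr \<alpha>"
      by (intro exI[of _ C] exI[of _ "1 / 3"] conjI; fact)
  next
    have le: "2 / 7 \<le> (1 / 3 :: real)" by simp
    show "\<exists>C>0. \<exists>\<alpha>\<ge>2 / 7. \<forall>N\<ge>1.
        \<forall>P\<in>cube_perms N. \<forall>Q\<in>cube_perms N.
          flow_dist N (P :: real^'n \<Rightarrow> real^'n) Q \<le> C * L2_dist P Q powr \<alpha>"
      by (intro exI[of _ C] exI[of _ "1 / 3"] conjI; fact)
  qed
qed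

end
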